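(* Let $G$ be an $FC^*$-group which is an $ERF$-group. Then for every right Engel element $a$ of $G$ of finite order there exists an integer $k=k(a)$ such that $a\in Z_k(G)$. Hence, if $G$ is periodic, then $R(G)=\overline{R}(G)=Z_{\omega}(G)$.
   Context: Commutators: $x^y=y^{-1}xy$, $[x,_1 y]=[x,y]=x^{-1}x^y$, and $[x,_m y]=[[x,_{m-1}y],y]$ for $m\geq 2$. For a group $G$, $R(G)$ is the set of right Engel elements, i.e. those $a\in G$ such that for every $g\in G$ there is $m=m(a,g)\geq 1$ with $[a,_m g]=1$; $\overline{R}(G)$ is the set of bounded right Engel elements, i.e. those $a\in G$ for which there is a single $m=m(a)\geq 1$ with $[a,_m g]=1$ for all $g\in G$. For $x\in G$, $x^G$ denotes the normal closure of $\langle x\rangle$ in $G$. $FC^0$ is the class of finite groups; for $n\geq 1$, a group $G$ is an $FC^n$-group if for every $x\in G$ the factor group $G/C_G(x^G)$ belongs to $FC^{n-1}$. A group is an $FC^*$-group if it is an $FC^n$-group for some integer $n\geq 0$. A group $G$ is an $ERF$-group (extended residually finite) if every subgroup of $G$ is closed in the profinite topology, i.e. every subgroup of $G$ is an intersection of subgroups of finite index in $G$. $Z_k(G)$ ($k\ge 0$ an integer) is the $k$-th term of the upper central series of $G$, and $Z_\omega(G)=\bigcup_{k<\omega}Z_k(G)$. A group is periodic if all its elements have finite order. *)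

theory Defs
  imports "HOL-Algebra.Algebra"
begin

section \<open>Engel elements\<close>

definition group_conj :: "('a, 'b) monoid_scheme \<Rightarrow> 'a \<Rightarrow> 'a \<Rightarrow> 'a" where
  "group_conj G x y = inv\<^bsub>G\<^esub> y \<otimes>\<^bsub>G\<^esub> x \<otimes>\<^bsub>G\<^esub> y"

definition group_comm :: "('a, 'b) monoid_scheme \<Rightarrow> 'a \<Rightarrow> 'a \<Rightarrow> 'a" where
  "group_comm G x y = inv\<^bsub>G\<^esub> x \<otimes>\<^bsub>G\<^esub> group_conj G x y"

text \<open>The left-normed commutator \<open>[x, y, ..., y]\<close> with \<open>m\<close> entries \<open>y\<close>; the value for \<open>m = 0\<close>
  is \<open>x\<close>, so that \<open>m = 1\<close> gives \<open>[x, y]\<close>.\<close>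

primrec engel_comm :: "('a, 'b) monoid_scheme \<Rightarrow> 'a \<Rightarrow> nat \<Rightarrow> 'a \<Rightarrow> 'a" where
  "engel_comm G x 0 y = x"
| "engel_comm G x (Suc m) y = group_comm G (engel_comm G x m y) y"

definition right_engel :: "('a, 'b) monoid_scheme \<Rightarrow> 'a set" where
  "right_engel G =
    {a \<in> carrier G. \<forall>g\<in>carrier G. \<exists>m\<ge>1. engel_comm G a m g = \<one>\<^bsub>G\<^esub>}"

definition bounded_right_engel :: "('a, 'b) monoid_scheme \<Rightarrow> 'a set" where
  "bounded_right_engel G =
    {a \<in> carrier G. \<exists>m\<ge>1. \<forall>g\<in>carrier G. engel_comm G a m g = \<one>\<^bsub>G\<^esub>}"

section \<open>Centralizers, normal closures, upper central series\<close>

definition centralizer :: "('a, 'b) monoid_scheme \<Rightarrow> 'a set \<Rightarrow> 'a set" where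
  "centralizer G S = {g \<in> carrier G. \<forall>s\<in>S. g \<otimes>\<^bsub>G\<^esub> s = s \<otimes>\<^bsub>G\<^esub> g}"

definition group_center :: "('a, 'b) monoid_scheme \<Rightarrow> 'a set" where
  "group_center G = centralizer G (carrier G)"

definition normal_closure :: "('a, 'b) monoid_scheme \<Rightarrow> 'a set \<Rightarrow> 'a set" where
  "normal_closure G S = \<Inter> {N. N \<lhd> G \<and> S \<subseteq> N}"

definition elem_normal_closure :: "('a, 'b) monoid_scheme \<Rightarrow> 'a \<Rightarrow> 'a set" where
  "elem_normal_closure G x = normal_closure G (generate G {x})"

text \<open>\<open>Z\<^sub>k\<^sub>+\<^sub>1(G)\<close> is the full preimage in \<open>G\<close> of the center of \<open>G/Z\<^sub>k(G)\<close>.\<close>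

primrec upper_central :: "('a, 'b) monoid_scheme \<Rightarrow> nat \<Rightarrow> 'a set" where
  "upper_central G 0 = {\<one>\<^bsub>G\<^esub>}"
| "upper_central G (Suc k) =
    {g \<in> carrier G. upper_central G k #>\<^bsub>G\<^esub> g \<in> group_center (G Mod upper_central G k)}"

definition upper_central_omega :: "('a, 'b) monoid_scheme \<Rightarrow> 'a set" where
  "upper_central_omega G = (\<Union>k. upper_central G k)"

section \<open>Periodic groups and extended residually finite groups\<close>

definition finite_order_elem :: "('a, 'b) monoid_scheme \<Rightarrow> 'a \<Rightarrow> bool" where
  "finite_order_elem G x \<longleftrightarrow> (\<exists>n::nat. n > 0 \<and> x [^]\<^bsub>G\<^esub> n = \<one>\<^bsub>G\<^esub>)"

definition periodic_group :: "('a, 'b) monoid_scheme \<Rightarrow> bool" where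
  "periodic_group G \<longleftrightarrow> group G \<and> (\<forall>x\<in>carrier G. finite_order_elem G x)"

definition finite_index_subgroup :: "'a set \<Rightarrow> ('a, 'b) monoid_scheme \<Rightarrow> bool" where
  "finite_index_subgroup K G \<longleftrightarrow> subgroup K G \<and> finite (rcosets\<^bsub>G\<^esub> K)"

text \<open>Since \<open>carrier G\<close> itself has finite index, requiring the family to be nonempty excludes
  nothing; it only avoids the HOL convention \<open>\<Inter> {} = UNIV\<close>.\<close>

definition ERF_group :: "('a, 'b) monoid_scheme \<Rightarrow> bool" where
  "ERF_group G \<longleftrightarrow> group G \<and>
    (\<forall>H. subgroup H G \<longrightarrow>
      (\<exists>\<F>. \<F> \<noteq> {} \<and> (\<forall>K\<in>\<F>. finite_index_subgroup K G) \<and> H = \<Inter> \<F>))"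

section \<open>Iterated FC-groups\<close>

text \<open>The factor group \<open>G Mod C\<close> has elements of type \<^typ>\<open>'a set\<close>, so the recursion cannot be
  applied to it directly in HOL. It is applied to an isomorphic copy of the factor group with
  elements of type \<^typ>\<open>'a\<close>, which always exists (choose coset representatives). Lemmas
  \<open>FC_group_iso\<close> and \<open>FC_group_Suc_iff\<close> below show that the choice of the copy does not
  matter, and that the predicate satisfies the intended recursion.\<close>

primrec FC_group :: "nat \<Rightarrow> 'a monoid \<Rightarrow> bool" where
  "FC_group 0 G \<longleftrightarrow> group G \<and> finite (carrier G)"
| "FC_group (Suc n) G \<longleftrightarrow> group G \<and>
    (\<forall>x\<in>carrier G. \<exists>H :: 'a monoid.
        G Mod centralizer G (elem_normal_closure G x) \<cong> H \<and> FC_group n H)"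

definition FC_star_group :: "'a monoid \<Rightarrow> bool" where
  "FC_star_group G \<longleftrightarrow> (\<exists>n. FC_group n G)"

lemma FC_group_is_group: "FC_group n G \<Longrightarrow> group G"
  by (cases n) auto

lemma generate_one_iso:
  assumes "group G" "group G'" "f \<in> iso G G'" "x \<in> carrier G"
  shows "f ` generate G {x} = generate G' {f x}"
proof -
  interpret group_hom G G' f
    using assms by (auto simp: group_hom_def group_hom_axioms_def iso_def)
  show ?thesis using generate_img[of "{x}"] assms by simp
qed

lemma normal_iso_image:
  assumes "group G" "group G'" "f \<in> iso G G'" "N \<lhd> G"
  shows "f ` N \<lhd> G'"
proof -
  interpret h: group_hom G G' f
    using assms by (auto simp: group_hom_def group_hom_axioms_def iso_def)
  interpret N: normal N G by fact
  have surj: "f ` carrier G = carrier G'" using assms by (simp add: iso_def bij_betw_def)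
  have sub: "subgroup (f ` N) G'"
    by (rule h.subgroup_img_is_subgroup) (rule N.subgroup_axioms)
  show ?thesis
  proof (rule group.normal_invI[OF assms(2) sub])
    fix g h assume "g \<in> carrier G'" "h \<in> f ` N"
    then obtain a b where ab: "a \<in> carrier G" "g = f a" "b \<in> N" "h = f b"
      using surj by (metis imageE)
    then have b: "b \<in> carrier G" using N.subset by blast
    have "a \<otimes>\<^bsub>G\<^esub> b \<otimes>\<^bsub>G\<^esub> inv\<^bsub>G\<^esub> a \<in> N" using ab N.inv_op_closed2 by simp
    moreover have "f (a \<otimes>\<^bsub>G\<^esub> b \<otimes>\<^bsub>G\<^esub> inv\<^bsub>G\<^esub> a) = g \<otimes>\<^bsub>G'\<^esub> h \<otimes>\<^bsub>G'\<^esub> inv\<^bsub>G'\<^esub> g"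
      using ab b by simp
    ultimately show "g \<otimes>\<^bsub>G'\<^esub> h \<otimes>\<^bsub>G'\<^esub> inv\<^bsub>G'\<^esub> g \<in> f ` N" by (metis imageI)
  qed
qed

lemma elem_normal_closure_subset:
  assumes "group G" "x \<in> carrier G"
  shows "elem_normal_closure G x \<subseteq> carrier G"
proof -
  have "carrier G \<lhd> G"
    using group.normal_inv_iff[OF assms(1)] group.subgroup_self[OF assms(1)]
    by (simp add: assms(1) group.is_monoid group.inv_closed monoid.m_closed)
  then show ?thesis
    using group.generate_incl[OF assms(1), of "{x}"] assms(2)
    unfolding elem_normal_closure_def normal_closure_def by blast
qed

lemma elem_normal_closure_normal:
  assumes G: "group G" and x: "x \<in> carrier G"
  shows "elem_normal_closure G x \<lhd> G"
proof -
  have c: "carrier G \<lhd> G"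
    using group.normal_inv_iff[OF G] group.subgroup_self[OF G]
    by (simp add: G group.is_monoid group.inv_closed monoid.m_closed)
  let ?F = "{N. N \<lhd> G \<and> generate G {x} \<subseteq> N}"
  have "carrier G \<in> ?F" using c group.generate_incl[OF G, of "{x}"] x by auto
  then have sub: "subgroup (\<Inter> ?F) G"
    using group.subgroups_Inter[OF G, of ?F] by (auto simp: group.normal_inv_iff[OF G])
  show ?thesis
    unfolding elem_normal_closure_def normal_closure_def
    using sub by (auto simp: group.normal_inv_iff[OF G])
qed

lemma centralizer_normal:
  assumes G: "group G" and N: "N \<lhd> G"
  shows "centralizer G N \<lhd> G"
proof -
  interpret group G by fact
  interpret N: normal N G by fact
  have Nc: "s \<in> carrier G" if "s \<in> N" for s using that N.subset by blast
  have c1: "inv\<^bsub>G\<^esub> g \<otimes>\<^bsub>G\<^esub> (g \<otimes>\<^bsub>G\<^esub> z) = z" if "g \<in> carrier G" "z \<in> carrier G" for g z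
    using that by (metis inv_closed l_inv l_one m_assoc)
  have c2: "g \<otimes>\<^bsub>G\<^esub> (inv\<^bsub>G\<^esub> g \<otimes>\<^bsub>G\<^esub> z) = z" if "g \<in> carrier G" "z \<in> carrier G" for g z
    using that by (metis inv_closed r_inv l_one m_assoc)
  have conj: "g \<otimes>\<^bsub>G\<^esub> c \<otimes>\<^bsub>G\<^esub> inv\<^bsub>G\<^esub> g \<in> centralizer G N"
    if g: "g \<in> carrier G" and c: "c \<in> centralizer G N" for g c
  proof -
    have cc: "c \<in> carrier G" using c by (simp add: centralizer_def)
    have "g \<otimes>\<^bsub>G\<^esub> c \<otimes>\<^bsub>G\<^esub> inv\<^bsub>G\<^esub> g \<otimes>\<^bsub>G\<^esub> s = s \<otimes>\<^bsub>G\<^esub> (g \<otimes>\<^bsub>G\<^esub> c \<otimes>\<^bsub>G\<^esub> inv\<^bsub>G\<^esub> g)" if s: "s \<in> N" for s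
    proof -
      define t where "t = inv\<^bsub>G\<^esub> g \<otimes>\<^bsub>G\<^esub> s \<otimes>\<^bsub>G\<^esub> g"
      have t: "t \<in> N" using N.inv_op_closed1 g s by (simp add: t_def)
      have tc: "t \<in> carrier G" using t Nc by blast
      have s_eq: "s = g \<otimes>\<^bsub>G\<^esub> t \<otimes>\<^bsub>G\<^esub> inv\<^bsub>G\<^esub> g"
        using g Nc[OF s] by (simp add: t_def m_assoc c2)
      have ct: "c \<otimes>\<^bsub>G\<^esub> t = t \<otimes>\<^bsub>G\<^esub> c" using c t by (simp add: centralizer_def)
      have "g \<otimes>\<^bsub>G\<^esub> c \<otimes>\<^bsub>G\<^esub> inv\<^bsub>G\<^esub> g \<otimes>\<^bsub>G\<^esub> s = g \<otimes>\<^bsub>G\<^esub> (c \<otimes>\<^bsub>G\<^esub> t) \<otimes>\<^bsub>G\<^esub> inv\<^bsub>G\<^esub> g"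
        unfolding s_eq using g cc tc by (simp add: m_assoc c1 c2)
      also have "\<dots> = s \<otimes>\<^bsub>G\<^esub> (g \<otimes>\<^bsub>G\<^esub> c \<otimes>\<^bsub>G\<^esub> inv\<^bsub>G\<^esub> g)"
        unfolding s_eq ct using g cc tc by (simp add: m_assoc c1 c2)
      finally show ?thesis .
    qed
    then show ?thesis using g cc by (simp add: centralizer_def)
  qed
  have sub: "subgroup (centralizer G N) G"
  proof (rule subgroupI)
    show "centralizer G N \<subseteq> carrier G" by (auto simp: centralizer_def)
    have "\<one>\<^bsub>G\<^esub> \<in> centralizer G N" using Nc by (simp add: centralizer_def)
    then show "centralizer G N \<noteq> {}" by blast
  next
    fix a assume a: "a \<in> centralizer G N"
    have ac: "a \<in> carrier G" using a by (simp add: centralizer_def)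
    have "inv\<^bsub>G\<^esub> a \<otimes>\<^bsub>G\<^esub> s = s \<otimes>\<^bsub>G\<^esub> inv\<^bsub>G\<^esub> a" if s: "s \<in> N" for s
    proof -
      have "a \<otimes>\<^bsub>G\<^esub> s = s \<otimes>\<^bsub>G\<^esub> a" using a s by (simp add: centralizer_def)
      then show ?thesis using ac Nc[OF s]
        by (metis inv_closed inv_solve_left inv_solve_right' m_assoc m_closed)
    qed
    then show "inv\<^bsub>G\<^esub> a \<in> centralizer G N" using ac by (simp add: centralizer_def)
  next
    fix a b assume a: "a \<in> centralizer G N" and b: "b \<in> centralizer G N"
    have ab: "a \<in> carrier G" "b \<in> carrier G" using a b by (auto simp: centralizer_def)
    have "a \<otimes>\<^bsub>G\<^esub> b \<otimes>\<^bsub>G\<^esub> s = s \<otimes>\<^bsub>G\<^esub> (a \<otimes>\<^bsub>G\<^esub> b)" if s: "s \<in> N" for s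
    proof -
      have "a \<otimes>\<^bsub>G\<^esub> s = s \<otimes>\<^bsub>G\<^esub> a" "b \<otimes>\<^bsub>G\<^esub> s = s \<otimes>\<^bsub>G\<^esub> b"
        using a b s by (simp_all add: centralizer_def)
      then show ?thesis using ab Nc[OF s] by (metis m_assoc)
    qed
    then show "a \<otimes>\<^bsub>G\<^esub> b \<in> centralizer G N" using ab by (simp add: centralizer_def)
  qed
  show ?thesis using sub conj by (auto simp: normal_inv_iff)
qed

lemma elem_normal_closure_iso_subset:
  assumes G: "group G" and G': "group G'" and f: "f \<in> iso G G'" and x: "x \<in> carrier G"
  shows "elem_normal_closure G' (f x) \<subseteq> f ` elem_normal_closure G x"
proof -
  have "generate G {x} \<subseteq> elem_normal_closure G x"
    by (auto simp: elem_normal_closure_def normal_closure_def)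
  then have "generate G' {f x} \<subseteq> f ` elem_normal_closure G x"
    using generate_one_iso[OF G G' f x] by blast
  moreover have "f ` elem_normal_closure G x \<lhd> G'"
    by (rule normal_iso_image[OF G G' f elem_normal_closure_normal[OF G x]])
  ultimately show ?thesis
    by (auto simp: elem_normal_closure_def[of G'] normal_closure_def)
qed

lemma elem_normal_closure_iso:
  assumes G: "group G" and G': "group G'" and f: "f \<in> iso G G'" and x: "x \<in> carrier G"
  shows "f ` elem_normal_closure G x = elem_normal_closure G' (f x)"
proof
  let ?g = "inv_into (carrier G) f"
  have g: "?g \<in> iso G' G" using group.iso_set_sym[OF G f] by simp
  have bij: "inj_on f (carrier G)" "f ` carrier G = carrier G'"
    using f by (auto simp: iso_def bij_betw_def)
  have fx: "f x \<in> carrier G'" using bij x by blast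
  have "elem_normal_closure G (?g (f x)) \<subseteq> ?g ` elem_normal_closure G' (f x)"
    by (rule elem_normal_closure_iso_subset[OF G' G g fx])
  then have "f ` elem_normal_closure G x \<subseteq> f ` ?g ` elem_normal_closure G' (f x)"
    using bij x by (simp add: image_mono)
  also have "\<dots> = elem_normal_closure G' (f x)"
    using elem_normal_closure_subset[OF G' fx] bij by (simp add: image_inv_into_cancel)
  finally show "f ` elem_normal_closure G x \<subseteq> elem_normal_closure G' (f x)" .
qed (rule elem_normal_closure_iso_subset[OF assms])

lemma FC_factor_iso:
  assumes G: "group G" and G': "group G'" and f: "f \<in> iso G G'" and x: "x \<in> carrier G"
  shows "G Mod centralizer G (elem_normal_closure G x)
    \<cong> G' Mod centralizer G' (elem_normal_closure G' (f x))"
proof -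
  let ?N = "elem_normal_closure G x" and ?N' = "elem_normal_closure G' (f x)"
  let ?C = "centralizer G ?N" and ?C' = "centralizer G' ?N'"
  have bij: "inj_on f (carrier G)" "f ` carrier G = carrier G'"
    using f by (auto simp: iso_def bij_betw_def)
  have fh: "f \<in> hom G G'" using f by (simp add: iso_def)
  have fx: "f x \<in> carrier G'" using bij x by blast
  have C': "?C' \<lhd> G'" by (rule centralizer_normal[OF G' elem_normal_closure_normal[OF G' fx]])
  interpret C': normal ?C' G' by (rule C')
  have Nsub: "?N \<subseteq> carrier G" by (rule elem_normal_closure_subset[OF G x])
  have mem: "f g \<in> ?C' \<longleftrightarrow> g \<in> ?C" if g: "g \<in> carrier G" for g
  proof -
    have "f g \<otimes>\<^bsub>G'\<^esub> f s = f s \<otimes>\<^bsub>G'\<^esub> f g \<longleftrightarrow> g \<otimes>\<^bsub>G\<^esub> s = s \<otimes>\<^bsub>G\<^esub> g" if s: "s \<in> ?N" for s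
    proof -
      have sc: "s \<in> carrier G" using s Nsub by blast
      have "g \<otimes>\<^bsub>G\<^esub> s \<in> carrier G" "s \<otimes>\<^bsub>G\<^esub> g \<in> carrier G"
        using g sc G by (simp_all add: group.is_monoid monoid.m_closed)
      then show ?thesis
        using hom_mult[OF fh g sc] hom_mult[OF fh sc g] inj_on_eq_iff[OF bij(1)] by metis
    qed
    then have "(\<forall>s\<in>?N. f g \<otimes>\<^bsub>G'\<^esub> f s = f s \<otimes>\<^bsub>G'\<^esub> f g) \<longleftrightarrow> (\<forall>s\<in>?N. g \<otimes>\<^bsub>G\<^esub> s = s \<otimes>\<^bsub>G\<^esub> g)"
      by blast
    moreover have "f g \<in> carrier G'" using g bij(2) by blast
    moreover have "(\<forall>s\<in>?N'. f g \<otimes>\<^bsub>G'\<^esub> s = s \<otimes>\<^bsub>G'\<^esub> f g) \<longleftrightarrow>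
        (\<forall>s\<in>?N. f g \<otimes>\<^bsub>G'\<^esub> f s = f s \<otimes>\<^bsub>G'\<^esub> f g)"
      unfolding elem_normal_closure_iso[OF assms, symmetric] by blast
    ultimately show ?thesis using g unfolding centralizer_def mem_Collect_eq by argo
  qed
  let ?h = "\<lambda>g. ?C' #>\<^bsub>G'\<^esub> f g"
  have hh: "?h \<in> hom G (G' Mod ?C')"
  proof -
    have "(\<lambda>a. ?C' #>\<^bsub>G'\<^esub> a) \<circ> f \<in> hom G (G' Mod ?C')"
      by (rule Group.hom_compose[OF fh C'.r_coset_hom_Mod])
    then show ?thesis unfolding comp_def .
  qed
  interpret h: group_hom G "G' Mod ?C'" ?h
    using G C'.factorgroup_is_group hh by (simp add: group_hom_def group_hom_axioms_def)
  have "?h ` carrier G = carrier (G' Mod ?C')"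
    unfolding carrier_FactGroup bij(2)[symmetric] image_image ..
  then have "G Mod kernel G (G' Mod ?C') ?h \<cong> G' Mod ?C'"
    by (rule h.FactGroup_iso)
  moreover have "kernel G (G' Mod ?C') ?h = ?C"
  proof -
    have "?C' #>\<^bsub>G'\<^esub> f g = ?C' \<longleftrightarrow> g \<in> ?C" if g: "g \<in> carrier G" for g
    proof -
      have "f g \<in> carrier G'" using g bij by blast
      then have "?C' #>\<^bsub>G'\<^esub> f g = ?C' \<longleftrightarrow> f g \<in> ?C'"
        using group.coset_join1[OF G' _ _ C'.subgroup_axioms]
          group.coset_join2[OF G' _ C'.subgroup_axioms] C'.subset by blast
      then show ?thesis using mem[OF g] by blast
    qed
    moreover have "?C \<subseteq> carrier G" unfolding centralizer_def by blast
    ultimately show ?thesis unfolding kernel_def one_FactGroup by blast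
  qed
  ultimately show ?thesis by simp
qed

lemma FC_factor_copy:
  fixes G :: "'a monoid"
  assumes "group G" "x \<in> carrier G"
  obtains H :: "'a monoid" where "group H"
    "G Mod centralizer G (elem_normal_closure G x) \<cong> H"
proof -
  let ?C = "centralizer G (elem_normal_closure G x)"
  interpret C: normal ?C G
    by (rule centralizer_normal[OF assms(1) elem_normal_closure_normal[OF assms]])
  show ?thesis
    using that C.flatten_set_group_mod C.flatten_set_group_mod_iso is_isoI by blast
qed

lemma factor_is_group:
  assumes "group G" "x \<in> carrier G"
  shows "group (G Mod centralizer G (elem_normal_closure G x))"
  by (rule normal.factorgroup_is_group[OF
        centralizer_normal[OF assms(1) elem_normal_closure_normal[OF assms]]])

lemma FC_group_iso_imp:
  fixes G :: "'a monoid" and G' :: "'b monoid"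
  assumes "FC_group n G" "group G'" "G \<cong> G'"
  shows "FC_group n G'"
  using assms
proof (induction n arbitrary: G G')
  case 0
  then show ?case using iso_finite by auto
next
  case (Suc n)
  have G: "group G" using Suc.prems(1) by simp
  obtain f where f: "f \<in> iso G G'" using Suc.prems(3) by (auto simp: is_iso_def)
  have "\<exists>H' :: 'b monoid. G' Mod centralizer G' (elem_normal_closure G' y) \<cong> H' \<and> FC_group n H'"
    if y: "y \<in> carrier G'" for y
  proof -
    obtain x where x: "x \<in> carrier G" "y = f x"
      using f y by (auto simp: iso_def bij_betw_def)
    obtain H :: "'a monoid" where H: "G Mod centralizer G (elem_normal_closure G x) \<cong> H" "FC_group n H"
      using Suc.prems(1) x(1) by auto
    obtain H' :: "'b monoid"
      where H': "group H'" "G' Mod centralizer G' (elem_normal_closure G' y) \<cong> H'"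
      using FC_factor_copy[OF Suc.prems(2) y] .
    have "H \<cong> G Mod centralizer G (elem_normal_closure G x)"
      using group.iso_sym[OF factor_is_group[OF G x(1)] H(1)] .
    also have "\<dots> \<cong> G' Mod centralizer G' (elem_normal_closure G' y)"
      unfolding x(2) by (rule FC_factor_iso[OF G Suc.prems(2) f x(1)])
    also have "\<dots> \<cong> H'" by (rule H'(2))
    finally have "FC_group n H'" using Suc.IH[OF H(2) H'(1)] by blast
    then show ?thesis using H'(2) by blast
  qed
  then show ?case using Suc.prems(2) by simp
qed

lemma FC_group_iso:
  fixes G :: "'a monoid" and G' :: "'b monoid"
  assumes "group G" "group G'" "G \<cong> G'"
  shows "FC_group n G \<longleftrightarrow> FC_group n G'"
proof
  assume "FC_group n G"
  then show "FC_group n G'" by (rule FC_group_iso_imp[OF _ assms(2,3)])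
next
  assume "FC_group n G'"
  then show "FC_group n G" by (rule FC_group_iso_imp[OF _ assms(1) group.iso_sym[OF assms(1,3)]])
qed

lemma FC_group_Suc_iff:
  "FC_group (Suc n) G \<longleftrightarrow> group G \<and>
    (\<forall>x\<in>carrier G. FC_group n (G Mod centralizer G (elem_normal_closure G x)))"
proof (cases "group G")
  case True
  have "(\<exists>H :: 'a monoid. G Mod centralizer G (elem_normal_closure G x) \<cong> H \<and> FC_group n H)
      \<longleftrightarrow> FC_group n (G Mod centralizer G (elem_normal_closure G x))"
    if x: "x \<in> carrier G" for x
    using FC_group_iso[OF factor_is_group[OF True x]] FC_factor_copy[OF True x]
      FC_group_is_group by metis
  then show ?thesis using True by simp
qed simp

end

theory Submission
  imports Defs
begin

text \<open>
  Write \<open>[A, G, \<dots>, G]\<close> with \<open>j\<close> entries \<open>G\<close> for the \<open>j\<close>-th term of the descending series of a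
  normal subgroup \<open>A\<close>. An element \<open>a\<close> lies in \<open>Z\<^sub>k(G)\<close> for some \<open>k\<close> exactly if this series reaches the
  trivial group for \<open>A = M\<close>, the normal closure of \<open>a\<close>. Three ideas combine to show that it does.

  Finite groups. In a finite group every right Engel element is hypercentral, a theorem of Baer
  (\<open>finite_right_engel_hypercentral\<close>). The proof is by induction on the order. If the conjugacy class of
  \<open>a\<close> lies in no proper subgroup, then by induction the class is hypercentral inside every proper
  subgroup as far as it meets it, and this forces different maximal subgroups to meet the class in
  disjoint sets (\<open>maximal_subgroups_disjoint_traces\<close>). If \<open>y\<close> is a conjugate of \<open>a\<close> in a maximal subgroup
  \<open>K\<close>, the relation \<open>[a, y, \<dots>, y] = 1\<close> can then be pulled back step by step to \<open>a \<in> K\<close>, so that \<open>K\<close>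
  is the only maximal subgroup containing \<open>a\<close>; as \<open>y\<close> was arbitrary, it contains the whole class. Hence the class lies in a proper subgroup and generates a nilpotent
  normal subgroup. Passing to quotients reduces to the case that this subgroup is a \<open>p\<close>-group; there the
  Engel condition makes all \<open>p'\<close>-elements act trivially, and counting conjugacy classes produces a
  nontrivial central element, which can be factored out.

  Closed subgroups. Baer's theorem shows that for each subgroup \<open>K\<close> of finite index some
  \<open>[M, G, \<dots>, G]\<close> lies in \<open>K\<close>, where the length depends on \<open>K\<close>. For an elementary abelian normal
  subgroup \<open>A\<close> with this property the dependence is harmless
  (\<open>elementary_abelian_lower_terminates\<close>): if the terms \<open>A\<^sub>j = [A, G, \<dots>, G]\<close> never became trivial, they
  would decrease strictly; elements \<open>e\<^sub>j\<close> of \<open>A\<^sub>j\<close> outside the next term are linearly independent,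
  so the subgroup generated by all \<open>e\<^sub>0 e\<^sub>j\<inverse>\<close> omits \<open>e\<^sub>0\<close>. Being closed, it is contained in a subgroup
  \<open>K\<close> of finite index that omits \<open>e\<^sub>0\<close>. But \<open>K\<close> contains some \<open>A\<^sub>j\<close>, hence \<open>e\<^sub>j\<close>, hence \<open>e\<^sub>0\<close>.
  Abelian factors of bounded exponent follow by splitting off one prime at a time.

  Iterated centralizers. In an \<open>FC\<^sup>n\<^sup>+\<^sup>1\<close>-group, induction on \<open>n\<close> applies to the factor group by the
  centralizer of \<open>M\<close>: so \<open>[M, G, \<dots>, G]\<close> centralizes \<open>M\<close> for some length, and \<open>M\<close> is nilpotent. As \<open>M\<close> is
  generated by conjugates of \<open>a\<close>, its lower central factors are abelian of exponent dividing the order of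
  \<open>a\<close>, and the previous paragraph applies to each of the finitely many factors.

  In the periodic case the equalities follow because \<open>Z\<^sub>k(G)\<close> consists of elements annihilated by every
  Engel word of length \<open>k\<close>.
\<close>

section \<open>Commutators and relative central series\<close>

text \<open>If \<open>N\<close> is a normal subgroup of \<open>S\<close>, this is the preimage in \<open>S\<close> of the \<open>k\<close>-th center of \<open>S/N\<close>. Keeping
  \<open>N\<close> as a parameter expresses hypercentrality modulo \<open>N\<close> by elements of \<open>G\<close> instead of cosets.\<close>

primrec rel_upper :: "('a, 'b) monoid_scheme \<Rightarrow> 'a set \<Rightarrow> 'a set \<Rightarrow> nat \<Rightarrow> 'a set" where
  "rel_upper G S N 0 = N"
| "rel_upper G S N (Suc k) = {x \<in> S. \<forall>g\<in>S. group_comm G x g \<in> rel_upper G S N k}"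

text \<open>The subgroup \<open>[A, S, \<dots>, S]\<close> with \<open>j\<close> entries \<open>S\<close>. For \<open>A = S\<close> this is the lower central series
  of \<open>S\<close>.\<close>

primrec rel_lower :: "('a, 'b) monoid_scheme \<Rightarrow> 'a set \<Rightarrow> 'a set \<Rightarrow> nat \<Rightarrow> 'a set" where
  "rel_lower G S A 0 = A"
| "rel_lower G S A (Suc j) =
    generate G {group_comm G x g |x g. x \<in> rel_lower G S A j \<and> g \<in> S}"

text \<open>Invariance under a set \<open>S\<close> that need not contain \<open>V\<close>: for \<open>S = carrier G\<close> this is normality
  (\<open>normal_iff_invariant\<close> below), and for a subgroup \<open>S\<close> it expresses that \<open>S\<close> normalizes \<open>V\<close>.\<close>

definition invariant_subgroup :: "('a, 'b) monoid_scheme \<Rightarrow> 'a set \<Rightarrow> 'a set \<Rightarrow> bool" where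
  "invariant_subgroup G S V \<longleftrightarrow> subgroup V G \<and> (\<forall>g\<in>S. \<forall>v\<in>V. group_conj G v g \<in> V)"

context group
begin

lemma inv_cancel_left: "g \<in> carrier G \<Longrightarrow> z \<in> carrier G \<Longrightarrow> inv g \<otimes> (g \<otimes> z) = z"
  by (metis inv_closed l_inv l_one m_assoc)

lemma inv_cancel_left': "g \<in> carrier G \<Longrightarrow> z \<in> carrier G \<Longrightarrow> g \<otimes> (inv g \<otimes> z) = z"
  by (metis inv_closed r_inv l_one m_assoc)

text \<open>Together with the group axioms these rules normalize words in group elements, which decides the
  commutator identities below.\<close>

lemmas word_simps = group_comm_def group_conj_def m_assoc inv_mult_group
  inv_cancel_left inv_cancel_left'

lemma comm_closed [simp]:
  "x \<in> carrier G \<Longrightarrow> y \<in> carrier G \<Longrightarrow> group_comm G x y \<in> carrier G"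
  by (simp add: group_comm_def group_conj_def)

lemma conj_closed [simp]:
  "x \<in> carrier G \<Longrightarrow> y \<in> carrier G \<Longrightarrow> group_conj G x y \<in> carrier G"
  by (simp add: group_conj_def)

lemma engel_closed [simp]:
  "x \<in> carrier G \<Longrightarrow> y \<in> carrier G \<Longrightarrow> engel_comm G x m y \<in> carrier G"
  by (induction m) auto

lemma comm_eq_one_iff:
  assumes "x \<in> carrier G" "y \<in> carrier G"
  shows "group_comm G x y = \<one> \<longleftrightarrow> x \<otimes> y = y \<otimes> x"
proof -
  have "group_comm G x y = inv (y \<otimes> x) \<otimes> (x \<otimes> y)" using assms by (simp add: word_simps)
  moreover have "inv (y \<otimes> x) \<otimes> (x \<otimes> y) = \<one> \<longleftrightarrow> x \<otimes> y = y \<otimes> x"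
    using assms inv_solve_left'[of "\<one>" "y \<otimes> x" "x \<otimes> y"] by simp
  ultimately show ?thesis by simp
qed

lemma one_comm [simp]: "g \<in> carrier G \<Longrightarrow> group_comm G \<one> g = \<one>"
  by (simp add: word_simps)

lemma one_conj [simp]: "g \<in> carrier G \<Longrightarrow> group_conj G \<one> g = \<one>"
  by (simp add: word_simps)

lemma conj_one [simp]: "g \<in> carrier G \<Longrightarrow> group_conj G g \<one> = g"
  by (simp add: word_simps)

lemma conj_mult: "x \<in> carrier G \<Longrightarrow> y \<in> carrier G \<Longrightarrow> g \<in> carrier G \<Longrightarrow>
    group_conj G (x \<otimes> y) g = group_conj G x g \<otimes> group_conj G y g"
  by (simp add: word_simps)

lemma conj_conj: "x \<in> carrier G \<Longrightarrow> g \<in> carrier G \<Longrightarrow> h \<in> carrier G \<Longrightarrow>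
    group_conj G (group_conj G x g) h = group_conj G x (g \<otimes> h)"
  by (simp add: word_simps)

lemma conj_inv: "x \<in> carrier G \<Longrightarrow> g \<in> carrier G \<Longrightarrow>
    group_conj G (inv x) g = inv (group_conj G x g)"
  by (simp add: word_simps)

lemma conj_inv_cancel [simp]: "x \<in> carrier G \<Longrightarrow> g \<in> carrier G \<Longrightarrow>
    group_conj G (group_conj G x g) (inv g) = x"
  by (simp add: conj_conj)

lemma conj_inv_cancel' [simp]: "x \<in> carrier G \<Longrightarrow> g \<in> carrier G \<Longrightarrow>
    group_conj G (group_conj G x (inv g)) g = x"
  by (simp add: conj_conj)

lemma conj_comm: "x \<in> carrier G \<Longrightarrow> y \<in> carrier G \<Longrightarrow> g \<in> carrier G \<Longrightarrow>
    group_conj G (group_comm G x y) g = group_comm G (group_conj G x g) (group_conj G y g)"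
  by (simp add: word_simps)

lemma conj_engel: "x \<in> carrier G \<Longrightarrow> y \<in> carrier G \<Longrightarrow> g \<in> carrier G \<Longrightarrow>
    group_conj G (engel_comm G x m y) g = engel_comm G (group_conj G x g) m (group_conj G y g)"
  by (induction m) (simp_all add: conj_comm)

lemma comm_mult_left: "x \<in> carrier G \<Longrightarrow> y \<in> carrier G \<Longrightarrow> g \<in> carrier G \<Longrightarrow>
    group_comm G (x \<otimes> y) g = group_conj G (group_comm G x g) y \<otimes> group_comm G y g"
  by (simp add: word_simps)

lemma comm_inv_left: "x \<in> carrier G \<Longrightarrow> g \<in> carrier G \<Longrightarrow>
    group_comm G (inv x) g = group_conj G (inv (group_comm G x g)) (inv x)"
  by (simp add: word_simps)

lemma comm_swap: "x \<in> carrier G \<Longrightarrow> y \<in> carrier G \<Longrightarrow>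
    group_comm G y x = inv (group_comm G x y)"
  by (simp add: word_simps)

lemma engel_add: "engel_comm G x (m + n) y = engel_comm G (engel_comm G x m y) n y"
  by (induction n) auto

lemma engel_Suc: "engel_comm G x (Suc m) y = engel_comm G (group_comm G x y) m y"
  using engel_add[of x 1 m y] by simp

lemma subgroup_comm: "subgroup V G \<Longrightarrow> x \<in> V \<Longrightarrow> y \<in> V \<Longrightarrow> group_comm G x y \<in> V"
  by (simp add: group_comm_def group_conj_def subgroup.m_closed subgroup.m_inv_closed)

lemma subgroup_conj: "subgroup V G \<Longrightarrow> x \<in> V \<Longrightarrow> y \<in> V \<Longrightarrow> group_conj G x y \<in> V"
  by (simp add: group_conj_def subgroup.m_closed subgroup.m_inv_closed)

lemma subgroup_pow: "subgroup V G \<Longrightarrow> x \<in> V \<Longrightarrow> x [^] (n::nat) \<in> V"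
  by (induction n) (simp_all add: subgroup.one_closed subgroup.m_closed)

lemma subgroup_memD: "subgroup V G \<Longrightarrow> x \<in> V \<Longrightarrow> x \<in> carrier G"
  using subgroup.subset by blast

subsection \<open>Invariant subgroups\<close>

lemma invariant_subgroupD:
  assumes "invariant_subgroup G S V"
  shows "subgroup V G" "\<And>g v. g \<in> S \<Longrightarrow> v \<in> V \<Longrightarrow> group_conj G v g \<in> V"
  using assms by (auto simp: invariant_subgroup_def)

lemma invariant_subgroup_comm:
  assumes "invariant_subgroup G S V" "S \<subseteq> carrier G" "v \<in> V" "g \<in> S"
  shows "group_comm G v g \<in> V"
  using invariant_subgroupD[OF assms(1)] assms(2-4) 
  by (metis group_comm_def subgroup.m_closed subgroup.m_inv_closed)

lemma invariant_subgroup_one: "S \<subseteq> carrier G \<Longrightarrow> invariant_subgroup G S {\<one>}"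
  by (auto simp: invariant_subgroup_def triv_subgroup)

lemma invariant_subgroup_self: "subgroup S G \<Longrightarrow> invariant_subgroup G S S"
  by (simp add: invariant_subgroup_def subgroup_conj)

lemma normal_iff_invariant: "V \<lhd> G \<longleftrightarrow> invariant_subgroup G (carrier G) V"
proof -
  have "(\<forall>x\<in>carrier G. \<forall>h\<in>V. x \<otimes> h \<otimes> inv x \<in> V) \<longleftrightarrow> (\<forall>x\<in>carrier G. \<forall>h\<in>V. inv x \<otimes> h \<otimes> x \<in> V)"
    by (metis inv_closed inv_inv)
  then show ?thesis by (auto simp: normal_inv_iff invariant_subgroup_def group_conj_def)
qed

lemma invariant_subgroup_generate:
  assumes "S \<subseteq> carrier G" "T \<subseteq> carrier G" "\<And>t g. t \<in> T \<Longrightarrow> g \<in> S \<Longrightarrow> group_conj G t g \<in> T"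
  shows "invariant_subgroup G S (generate G T)"
proof -
  have "group_conj G v g \<in> generate G T" if g: "g \<in> S" and v: "v \<in> generate G T" for g v
    using v
  proof (induction rule: generate.induct)
    case one
    show ?case using g assms(1) generate.one[of G T] by (auto simp: subset_iff)
  next
    case (incl h)
    then show ?case using g assms(3) by (simp add: generate.incl)
  next
    case (inv h)
    then show ?case using g assms by (simp add: generate.inv conj_inv subset_iff)
  next
    case (eng h1 h2)
    then show ?case using g assms generate_in_carrier[OF assms(2)]
      by (simp add: conj_mult generate.eng subset_iff)
  qed
  then show ?thesis by (simp add: invariant_subgroup_def generate_is_subgroup assms(2))
qed

subsection \<open>The relative upper central series\<close>

lemma invariant_subgroup_rel_upper:
  assumes S: "subgroup S G" and N: "invariant_subgroup G S N"
  shows "invariant_subgroup G S (rel_upper G S N k)"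
proof (induction k)
  case 0
  then show ?case using N by simp
next
  case (Suc k)
  let ?V = "rel_upper G S N k" and ?W = "rel_upper G S N (Suc k)"
  have V: "subgroup ?V G" and Vc: "\<And>g v. g \<in> S \<Longrightarrow> v \<in> ?V \<Longrightarrow> group_conj G v g \<in> ?V"
    using invariant_subgroupD[OF Suc] by auto
  have Xc: "\<And>x. x \<in> S \<Longrightarrow> x \<in> carrier G" using S subgroup_memD by blast
  have Xi: "\<And>x. x \<in> S \<Longrightarrow> inv x \<in> S" using S by (simp add: subgroup.m_inv_closed)
  have "subgroup ?W G"
  proof (rule subgroupI)
    show "?W \<subseteq> carrier G" using Xc by auto
    have "\<one> \<in> ?W" using S V Xc by (simp add: subgroup.one_closed)
    then show "?W \<noteq> {}" by blast
  next
    fix x assume "x \<in> ?W"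
    then show "inv x \<in> ?W" using Xi Xc Vc V
      by (simp add: comm_inv_left subgroup.m_inv_closed)
  next
    fix x y assume "x \<in> ?W" "y \<in> ?W"
    then show "x \<otimes> y \<in> ?W" using Xc Vc V S
      by (simp add: comm_mult_left subgroup.m_closed)
  qed
  moreover have "group_conj G x h \<in> ?W" if "x \<in> ?W" "h \<in> S" for x h
  proof -
    have "group_comm G (group_conj G x h) g \<in> ?V" if g: "g \<in> S" for g
    proof -
      have "group_conj G (group_comm G x (group_conj G g (inv h))) h \<in> ?V"
        using \<open>x \<in> ?W\<close> \<open>h \<in> S\<close> g Vc Xi subgroup_conj[OF S] by simp
      then show ?thesis using \<open>x \<in> ?W\<close> \<open>h \<in> S\<close> g Xc by (simp add: conj_comm)
    qed
    then show ?thesis using that subgroup_conj[OF S] by simp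
  qed
  ultimately show ?case by (simp add: invariant_subgroup_def)
qed

lemma rel_upper_subset:
  assumes "N \<subseteq> S" shows "rel_upper G S N k \<subseteq> S"
  using assms by (cases k) auto

lemma rel_upper_Suc_mono:
  assumes S: "subgroup S G" and N: "invariant_subgroup G S N" "N \<subseteq> S"
  shows "rel_upper G S N k \<subseteq> rel_upper G S N (Suc k)"
proof
  fix x assume x: "x \<in> rel_upper G S N k"
  then have "x \<in> S" using rel_upper_subset[OF N(2)] by blast
  then show "x \<in> rel_upper G S N (Suc k)"
    using x invariant_subgroup_comm[OF invariant_subgroup_rel_upper[OF S N(1)] subgroup.subset[OF S]]
    by simp
qed

lemma rel_upper_mono:
  assumes "subgroup S G" "invariant_subgroup G S N" "N \<subseteq> S" "j \<le> k"
  shows "rel_upper G S N j \<subseteq> rel_upper G S N k"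
  by (rule lift_Suc_mono_le[of "rel_upper G S N", OF rel_upper_Suc_mono[OF assms(1-3)] assms(4)])

lemma rel_upper_add: "rel_upper G S (rel_upper G S N i) j = rel_upper G S N (i + j)"
  by (induction j) auto

lemma rel_upper_Int: "rel_upper G S (N \<inter> N') k = rel_upper G S N k \<inter> rel_upper G S N' k"
  by (induction k) auto

text \<open>Hypercentrality is inherited by subgroups, since fewer commutators have to be considered.\<close>

lemma rel_upper_Int_subgroup:
  assumes "subgroup Y G" "Y \<subseteq> S"
  shows "rel_upper G S {\<one>} k \<inter> Y \<subseteq> rel_upper G Y {\<one>} k"
  using assms by (induction k) (auto simp: subgroup_comm subset_iff)

lemma engel_in_rel_upper:
  assumes "x \<in> rel_upper G S N k" "g \<in> S"
  shows "engel_comm G x k g \<in> N"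
  using assms(1)
proof (induction k arbitrary: x)
  case (Suc k)
  then have "group_comm G x g \<in> rel_upper G S N k" using assms by simp
  then show ?case unfolding engel_Suc using Suc.IH by blast
qed simp

subsection \<open>The relative lower central series\<close>

lemma invariant_subgroup_rel_lower:
  assumes Y: "Y \<subseteq> carrier G" and A: "invariant_subgroup G Y A" 
    and S: "invariant_subgroup G Y S"
  shows "invariant_subgroup G Y (rel_lower G S A j)"
proof (induction j)
  case (Suc j)
  note L = invariant_subgroupD[OF Suc] and XD = invariant_subgroupD[OF S]
  have "invariant_subgroup G Y
      (generate G {group_comm G x g |x g. x \<in> rel_lower G S A j \<and> g \<in> S})"
  proof (rule invariant_subgroup_generate[OF Y])
    show "{group_comm G x g |x g. x \<in> rel_lower G S A j \<and> g \<in> S} \<subseteq> carrier G"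
      using subgroup_memD[OF L(1)] subgroup_memD[OF XD(1)] by auto
  next
    fix t h assume "t \<in> {group_comm G x g |x g. x \<in> rel_lower G S A j \<and> g \<in> S}" and h: "h \<in> Y"
    then obtain x g where t: "t = group_comm G x g" "x \<in> rel_lower G S A j" "g \<in> S" by blast
    have "group_conj G t h = group_comm G (group_conj G x h) (group_conj G g h)"
      using t h Y subgroup_memD[OF L(1)] subgroup_memD[OF XD(1)] by (auto simp: conj_comm)
    then show "group_conj G t h \<in> {group_comm G x g |x g. x \<in> rel_lower G S A j \<and> g \<in> S}"
      using t h L(2) XD(2) by blast
  qed
  then show ?case by simp
qed (use A in simp)

lemma comm_in_rel_lower: "x \<in> rel_lower G S A j \<Longrightarrow> g \<in> S \<Longrightarrow> group_comm G x g \<in> rel_lower G S A (Suc j)"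
  by (auto intro!: generate.incl)

lemma rel_lower_Suc_leI:
  assumes "subgroup V G" "\<And>x g. x \<in> rel_lower G S A j \<Longrightarrow> g \<in> S \<Longrightarrow> group_comm G x g \<in> V"
  shows "rel_lower G S A (Suc j) \<subseteq> V"
proof -
  have "{group_comm G x g |x g. x \<in> rel_lower G S A j \<and> g \<in> S} \<subseteq> V" using assms(2) by blast
  then show ?thesis using generate_subgroup_incl[OF _ assms(1)] by simp
qed

lemma rel_lower_Suc_subset:
  assumes "S \<subseteq> carrier G" "invariant_subgroup G S A" "invariant_subgroup G S S"
  shows "rel_lower G S A (Suc j) \<subseteq> rel_lower G S A j"
proof -
  note L = invariant_subgroup_rel_lower[OF assms, of j]
  show ?thesis
    by (rule rel_lower_Suc_leI[OF invariant_subgroupD(1)[OF L]])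
      (rule invariant_subgroup_comm[OF L assms(1)])
qed

lemma rel_lower_mono:
  assumes "S \<subseteq> carrier G" "invariant_subgroup G S A" "invariant_subgroup G S S" "i \<le> j"
  shows "rel_lower G S A j \<subseteq> rel_lower G S A i"
  by (rule lift_Suc_antimono_le[of "rel_lower G S A", OF rel_lower_Suc_subset[OF assms(1-3)] assms(4)])

text \<open>
  The next two lemmas show that \<open>[A, S, \<dots>, S]\<close> with \<open>j\<close> entries lies in \<open>N\<close> exactly if \<open>A\<close> lies in the
  \<open>j\<close>-th relative center above \<open>N\<close>: each step moves one commutator from one side to the other.
\<close>

lemma rel_lower_subset_if_rel_upper:
  assumes S: "subgroup S G" and N: "invariant_subgroup G S N"
    and "A \<subseteq> rel_upper G S N (i + j)"
  shows "rel_lower G S A j \<subseteq> rel_upper G S N i"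
  using assms(3)
proof (induction j arbitrary: i)
  case (Suc j)
  have "rel_lower G S A j \<subseteq> rel_upper G S N (Suc i)" by (rule Suc.IH) (use Suc.prems in simp)
  then show ?case 
    using invariant_subgroupD(1)[OF invariant_subgroup_rel_upper[OF S N]]
    by (intro rel_lower_Suc_leI) auto
qed simp

lemma rel_upper_if_rel_lower_subset:
  assumes "rel_lower G S A j \<subseteq> rel_upper G S N i" "\<And>j. rel_lower G S A j \<subseteq> S"
  shows "A \<subseteq> rel_upper G S N (i + j)"
  using assms(1)
proof (induction j arbitrary: i)
  case (Suc j)
  have "rel_lower G S A j \<subseteq> rel_upper G S N (Suc i)"
    using assms(2)[of j] Suc.prems comm_in_rel_lower[of _ S A j] by auto
  then show ?case using Suc.IH[of "Suc i"] by simp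
qed simp

end

section \<open>Surjective homomorphisms and quotients\<close>

text \<open>The separation form of the ERF property. Unlike intersections of families, it passes directly to
  homomorphic images.\<close>

definition finite_index_separable :: "('a, 'b) monoid_scheme \<Rightarrow> bool" where
  "finite_index_separable G \<longleftrightarrow> (\<forall>S x. subgroup S G \<longrightarrow> x \<in> carrier G \<longrightarrow> x \<notin> S \<longrightarrow>
     (\<exists>K. finite_index_subgroup K G \<and> S \<subseteq> K \<and> x \<notin> K))"

lemma ERF_group_separable:
  assumes "ERF_group G" shows "finite_index_separable G"
proof -
  have "\<exists>K. finite_index_subgroup K G \<and> S \<subseteq> K \<and> x \<notin> K" if S: "subgroup S G" "x \<notin> S" for S x
  proof -
    obtain \<F> where "\<forall>K\<in>\<F>. finite_index_subgroup K G" "S = \<Inter> \<F>"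
      using assms S(1) by (auto simp: ERF_group_def)
    then show ?thesis using S(2) by blast
  qed
  then show ?thesis by (simp add: finite_index_separable_def)
qed

lemma finite_index_separableD:
  assumes "finite_index_separable G" "subgroup S G" "x \<in> carrier G" "x \<notin> S"
  obtains K where "finite_index_subgroup K G" "S \<subseteq> K" "x \<notin> K"
  using assms unfolding finite_index_separable_def by blast

locale group_epi = group_hom +
  assumes surj: "h ` carrier G = carrier H"
begin

lemma hom_conj [simp]: "x \<in> carrier G \<Longrightarrow> y \<in> carrier G \<Longrightarrow>
    h (group_conj G x y) = group_conj H (h x) (h y)"
  by (simp add: group_conj_def)

lemma hom_comm [simp]: "x \<in> carrier G \<Longrightarrow> y \<in> carrier G \<Longrightarrow>
    h (group_comm G x y) = group_comm H (h x) (h y)"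
  by (simp add: group_comm_def)

lemma hom_engel: "x \<in> carrier G \<Longrightarrow> y \<in> carrier G \<Longrightarrow>
    h (engel_comm G x m y) = engel_comm H (h x) m (h y)"
  by (induction m) simp_all

lemma ball_surj: "(\<forall>y\<in>carrier H. P y) \<longleftrightarrow> (\<forall>x\<in>carrier G. P (h x))"
  by (simp flip: surj)

text \<open>Relative centers of \<open>G\<close> above the preimage of \<open>K\<close> are preimages of relative centers of \<open>H\<close> above \<open>K\<close>;
  with \<open>K = 1\<close> this transfers hypercentrality in a quotient back to \<open>G\<close>.\<close>

lemma rel_upper_preimage_iff:
  assumes "x \<in> carrier G"
  shows "x \<in> rel_upper G (carrier G) {y \<in> carrier G. h y \<in> K} k \<longleftrightarrow>
         h x \<in> rel_upper H (carrier H) K k"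
  using assms by (induction k arbitrary: x) (simp_all add: ball_surj)

lemma rel_lower_image:
  assumes "subgroup S G" "subgroup A G" "A \<subseteq> S" 
  shows "rel_lower H (h ` S) (h ` A) j = h ` rel_lower G S A j \<and> rel_lower G S A j \<subseteq> S"
proof (induction j)
  case (Suc j)
  let ?T = "{group_comm G x g |x g. x \<in> rel_lower G S A j \<and> g \<in> S}"
  have Sc: "S \<subseteq> carrier G" using assms(1) by (rule subgroup.subset)
  have T: "?T \<subseteq> S" using Suc G.subgroup_comm[OF assms(1)] by blast
  have "{group_comm H x g |x g. x \<in> rel_lower H (h ` S) (h ` A) j \<and> g \<in> h ` S} = h ` ?T"
  proof (intro equalityI subsetI)
    fix t assume "t \<in> {group_comm H x g |x g. x \<in> rel_lower H (h ` S) (h ` A) j \<and> g \<in> h ` S}"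
    then obtain x g where "t = group_comm H (h x) (h g)" "x \<in> rel_lower G S A j" "g \<in> S"
      using Suc by auto
    moreover from this have "t = h (group_comm G x g)" using Suc Sc by (simp add: subset_iff)
    ultimately show "t \<in> h ` ?T" by blast
  next
    fix t assume "t \<in> h ` ?T"
    then obtain x g where t: "t = h (group_comm G x g)" "x \<in> rel_lower G S A j" "g \<in> S" by blast
    then have "t = group_comm H (h x) (h g)" using Suc Sc by (simp add: subset_iff)
    then show "t \<in> {group_comm H x g |x g. x \<in> rel_lower H (h ` S) (h ` A) j \<and> g \<in> h ` S}"
      using t Suc by blast
  qed
  then have "rel_lower H (h ` S) (h ` A) (Suc j) = generate H (h ` ?T)" by simp
  also have "\<dots> = h ` generate G ?T" using generate_img T Sc by (metis (no_types, lifting) order_trans)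
  finally show ?case using G.generate_subgroup_incl[OF T assms(1)] by simp
qed (use assms in simp)

lemma subgroup_preimage:
  assumes "subgroup K H" shows "subgroup {x \<in> carrier G. h x \<in> K} G"
  by (rule G.subgroupI)
    (use assms in \<open>auto simp: subgroup.one_closed subgroup.m_closed subgroup.m_inv_closed
        intro!: exI[of _ "\<one>\<^bsub>G\<^esub>"]\<close>)

lemma finite_index_preimage:
  assumes "finite_index_subgroup K H"
  shows "finite_index_subgroup {x \<in> carrier G. h x \<in> K} G"
proof -
  let ?K' = "{x \<in> carrier G. h x \<in> K}"
  have K: "subgroup K H" using assms by (simp add: finite_index_subgroup_def)
  have Kc: "K \<subseteq> carrier H" using K by (rule subgroup.subset)
  have coset: "?K' #>\<^bsub>G\<^esub> x = {g \<in> carrier G. h g \<in> K #>\<^bsub>H\<^esub> h x}" if x: "x \<in> carrier G" for x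
  proof (intro equalityI subsetI)
    fix g assume "g \<in> ?K' #>\<^bsub>G\<^esub> x"
    then show "g \<in> {g \<in> carrier G. h g \<in> K #>\<^bsub>H\<^esub> h x}"
      using x by (auto simp: r_coset_def)
  next
    fix g assume "g \<in> {g \<in> carrier G. h g \<in> K #>\<^bsub>H\<^esub> h x}"
    then obtain k where g: "g \<in> carrier G" "k \<in> K" "h g = k \<otimes>\<^bsub>H\<^esub> h x" by (auto simp: r_coset_def)
    then have "h (g \<otimes>\<^bsub>G\<^esub> inv\<^bsub>G\<^esub> x) = k" using x Kc
      by (simp add: subset_iff H.m_assoc)
    then have "g \<otimes>\<^bsub>G\<^esub> inv\<^bsub>G\<^esub> x \<in> ?K'" using g x by simp
    moreover have "g = g \<otimes>\<^bsub>G\<^esub> inv\<^bsub>G\<^esub> x \<otimes>\<^bsub>G\<^esub> x" using g x by (simp add: G.m_assoc)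
    ultimately show "g \<in> ?K' #>\<^bsub>G\<^esub> x" unfolding r_coset_def by blast
  qed
  have "C \<in> (\<lambda>C. {g \<in> carrier G. h g \<in> C}) ` (rcosets\<^bsub>H\<^esub> K)" if C: "C \<in> rcosets\<^bsub>G\<^esub> ?K'" for C
  proof -
    obtain x where x: "x \<in> carrier G" "C = ?K' #>\<^bsub>G\<^esub> x"
      using C by (auto simp: RCOSETS_def)
    then have "K #>\<^bsub>H\<^esub> h x \<in> rcosets\<^bsub>H\<^esub> K" by (auto simp: RCOSETS_def)
    then show ?thesis using coset x by blast
  qed
  then have "rcosets\<^bsub>G\<^esub> ?K' \<subseteq> (\<lambda>C. {g \<in> carrier G. h g \<in> C}) ` (rcosets\<^bsub>H\<^esub> K)" by blast
  then have "finite (rcosets\<^bsub>G\<^esub> ?K')"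
    using assms finite_surj unfolding finite_index_subgroup_def by blast
  then show ?thesis using subgroup_preimage[OF K] by (simp add: finite_index_subgroup_def)
qed

lemma finite_index_image:
  assumes "finite_index_subgroup K G"
  shows "finite_index_subgroup (h ` K) H"
proof -
  have K: "subgroup K G" using assms by (simp add: finite_index_subgroup_def)
  have Kc: "K \<subseteq> carrier G" using K by (rule subgroup.subset)
  have coset: "h ` K #>\<^bsub>H\<^esub> h x = h ` (K #>\<^bsub>G\<^esub> x)" if x: "x \<in> carrier G" for x
  proof -
    have "h (k \<otimes>\<^bsub>G\<^esub> x) = h k \<otimes>\<^bsub>H\<^esub> h x" if "k \<in> K" for k using that x Kc by auto
    then show ?thesis unfolding r_coset_def image_UN by simp
  qed
  have "C \<in> (`) h ` (rcosets\<^bsub>G\<^esub> K)" if C: "C \<in> rcosets\<^bsub>H\<^esub> (h ` K)" for C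
  proof -
    obtain x where "x \<in> carrier G" "C = h ` K #>\<^bsub>H\<^esub> h x"
      using C by (auto simp: RCOSETS_def simp flip: surj)
    then show ?thesis using coset by (auto simp: RCOSETS_def)
  qed
  then have "rcosets\<^bsub>H\<^esub> (h ` K) \<subseteq> (`) h ` (rcosets\<^bsub>G\<^esub> K)" by blast
  then have "finite (rcosets\<^bsub>H\<^esub> (h ` K))"
    using assms finite_surj unfolding finite_index_subgroup_def by blast
  then show ?thesis using subgroup_img_is_subgroup[OF K] by (simp add: finite_index_subgroup_def)
qed

text \<open>A subgroup of \<open>H\<close> is separated from an element by separating its preimage in \<open>G\<close>. The subgroup found
  there contains the kernel, because the preimage does, so its image still omits the element.\<close>

lemma finite_index_separable_image:
  assumes sep: "finite_index_separable G"
  shows "finite_index_separable H"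
  unfolding finite_index_separable_def
proof (intro allI impI)
  fix S y assume S: "subgroup S H" and y: "y \<in> carrier H" "y \<notin> S"
  obtain x where x: "x \<in> carrier G" "y = h x" using y surj by blast
  let ?S' = "{x \<in> carrier G. h x \<in> S}"
  obtain K where K: "finite_index_subgroup K G" "?S' \<subseteq> K" "x \<notin> K"
    by (rule finite_index_separableD[OF sep subgroup_preimage[OF S] x(1)]) (use x y in auto)
  have Ks: "subgroup K G" using K(1) by (simp add: finite_index_subgroup_def)
  have "S \<subseteq> h ` K"
  proof
    fix s assume s: "s \<in> S"
    then obtain g where "g \<in> carrier G" "s = h g" using subgroup.subset[OF S] surj by blast
    then show "s \<in> h ` K" using s K(2) by blast
  qed
  moreover have "y \<notin> h ` K"
  proof
    assume "y \<in> h ` K"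
    then obtain k where k: "k \<in> K" "h x = h k" unfolding x(2) by auto
    have kc: "k \<in> carrier G" using k subgroup.subset[OF Ks] by blast
    have "h (x \<otimes>\<^bsub>G\<^esub> inv\<^bsub>G\<^esub> k) = \<one>\<^bsub>H\<^esub>" using k(2) x(1) kc by simp
    then have "x \<otimes>\<^bsub>G\<^esub> inv\<^bsub>G\<^esub> k \<in> ?S'" using subgroup.one_closed[OF S] x(1) kc by simp
    then have "x \<otimes>\<^bsub>G\<^esub> inv\<^bsub>G\<^esub> k \<in> K" using K(2) by blast
    then have "x \<otimes>\<^bsub>G\<^esub> inv\<^bsub>G\<^esub> k \<otimes>\<^bsub>G\<^esub> k \<in> K" using k subgroup.m_closed[OF Ks] by blast
    then show False using K(3) x(1) kc by (simp add: G.m_assoc)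
  qed
  ultimately show "\<exists>K. finite_index_subgroup K H \<and> S \<subseteq> K \<and> y \<notin> K"
    using finite_index_image[OF K(1)] by blast
qed

end

lemma group_epi_compose_iso:
  assumes "group_epi G H h" "f \<in> iso H L" "group L"
  shows "group_epi G L (f \<circ> h)" 
    and "\<And>x. x \<in> carrier G \<Longrightarrow> (f \<circ> h) x = \<one>\<^bsub>L\<^esub> \<longleftrightarrow> h x = \<one>\<^bsub>H\<^esub>"
proof -
  interpret h: group_epi G H h by fact
  interpret f: group_hom H L f
    using assms h.H.group_axioms by (simp add: group_hom_def group_hom_axioms_def iso_def)
  have bij: "bij_betw f (carrier H) (carrier L)" using assms(2) by (simp add: iso_def)
  have "f \<circ> h \<in> hom G L" using Group.hom_compose[OF h.homh f.homh] .
  then show "group_epi G L (f \<circ> h)"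
    using bij h.surj by unfold_locales (simp_all add: image_image[of f h, symmetric] bij_betw_def)
  show "(f \<circ> h) x = \<one>\<^bsub>L\<^esub> \<longleftrightarrow> h x = \<one>\<^bsub>H\<^esub>" if "x \<in> carrier G" for x
    using inj_on_eq_iff[OF bij_betw_imp_inj_on[OF bij], of "h x" "\<one>\<^bsub>H\<^esub>"] that by simp
qed

lemma (in normal) group_epi_Mod:
  "group_epi G (G Mod H) ((#>) H)" "x \<in> carrier G \<Longrightarrow> H #> x = \<one>\<^bsub>G Mod H\<^esub> \<longleftrightarrow> x \<in> H"
proof -
  show "group_epi G (G Mod H) ((#>) H)"
    by (simp add: group_epi_def group_hom_def group_hom_axioms_def group_epi_axioms_def
        factorgroup_is_group r_coset_hom_Mod carrier_FactGroup is_group)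
  show "H #> x = \<one>\<^bsub>G Mod H\<^esub> \<longleftrightarrow> x \<in> H" if "x \<in> carrier G"
    using that coset_join1[OF _ that subgroup_axioms] coset_join2[OF that subgroup_axioms]
    by (auto simp: subset)
qed

text \<open>Choosing coset representatives gives a quotient on the original type, so that inductions over
  groups can be applied to quotients.\<close>

lemma (in group) quotient_copy:
  assumes "N \<lhd> G"
  obtains H :: "'a monoid" and h where "group_epi G H h"
    "\<And>x. x \<in> carrier G \<Longrightarrow> h x = \<one>\<^bsub>H\<^esub> \<longleftrightarrow> x \<in> N"
proof -
  interpret N: normal N G by fact
  obtain rep and L :: "'a monoid" where L: "group L" "rep \<in> iso (G Mod N) L"
    using N.flatten_set_group_mod N.flatten_set_group_mod_iso by blast
  show ?thesis
    using that[OF group_epi_compose_iso(1)[OF N.group_epi_Mod(1) L(2,1)]]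
      group_epi_compose_iso(2)[OF N.group_epi_Mod(1) L(2,1)] N.group_epi_Mod(2) by blast
qed

text \<open>The core \<open>N\<close> of a subgroup \<open>K\<close> of finite index has finite index: the coset of \<open>g\<close> modulo \<open>N\<close> is
  determined by the map that \<open>g\<close> induces on the finite set of cosets of \<open>K\<close>.\<close>

lemma (in group) finite_quotient_below:
  assumes "finite_index_subgroup K G"
  obtains H :: "'a monoid" and h where "group_epi G H h" "finite (carrier H)"
    "\<And>x. x \<in> carrier G \<Longrightarrow> h x = \<one>\<^bsub>H\<^esub> \<Longrightarrow> x \<in> K"
proof -
  have K: "subgroup K G" and fin: "finite (rcosets K)"
    using assms by (auto simp: finite_index_subgroup_def)
  define N where "N = {g \<in> carrier G. \<forall>x\<in>carrier G. group_conj G g x \<in> K}"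
  have "subgroup N G"
  proof (rule subgroupI)
    show "N \<subseteq> carrier G" by (auto simp: N_def)
    have "\<one> \<in> N" using subgroup.one_closed[OF K] by (simp add: N_def)
    then show "N \<noteq> {}" by blast
  qed (simp_all add: N_def conj_inv conj_mult subgroup.m_closed[OF K] subgroup.m_inv_closed[OF K])
  then have "N \<lhd> G" by (auto simp: normal_iff_invariant invariant_subgroup_def N_def conj_conj)
  then obtain H :: "'a monoid" and h where H: "group_epi G H h"
    "\<And>x. x \<in> carrier G \<Longrightarrow> h x = \<one>\<^bsub>H\<^esub> \<longleftrightarrow> x \<in> N"
    by (rule quotient_copy) auto
  interpret h: group_epi G H h by fact
  have "x \<in> K" if "x \<in> N" for x 
  proof -
    have "group_conj G x \<one> \<in> K" "x \<in> carrier G" using that unfolding N_def by blast+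
    then show ?thesis by simp
  qed
  moreover have "finite (h ` carrier G)"
  proof -
    define F where "F g = (\<lambda>C\<in>rcosets K. C #> g)" for g
    have "F ` carrier G \<subseteq> rcosets K \<rightarrow>\<^sub>E rcosets K"
    proof clarify
      fix g assume g: "g \<in> carrier G"
      show "F g \<in> rcosets K \<rightarrow>\<^sub>E rcosets K"
        using g subgroup.subset[OF K]
        by (auto simp: F_def RCOSETS_def coset_mult_assoc)
    qed
    then have "finite (F ` carrier G)"
      using finite_PiE[OF fin, of "\<lambda>_. rcosets K"] fin finite_subset by blast
    moreover have "h g = h g'" if g: "g \<in> carrier G" "g' \<in> carrier G" and eq: "F g = F g'" for g g'
    proof -
      have "group_conj G (g \<otimes> inv g') x \<in> K" if x: "x \<in> carrier G" for x
      proof -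
        have "F g (K #> inv x) = F g' (K #> inv x)" using eq by simp
        moreover have "K #> inv x \<in> rcosets K" using x by (auto simp: RCOSETS_def)
        ultimately have "K #> (inv x \<otimes> g) = K #> (inv x \<otimes> g')"
          using x g subgroup.subset[OF K] by (simp add: F_def coset_mult_assoc)
        then have "inv x \<otimes> g \<in> K #> (inv x \<otimes> g')"
          using rcos_self[OF _ K, of "inv x \<otimes> g"] x g by simp
        then obtain k where k: "k \<in> K" "inv x \<otimes> g = k \<otimes> (inv x \<otimes> g')" by (auto simp: r_coset_def)
        have "group_conj G (g \<otimes> inv g') x = inv x \<otimes> g \<otimes> inv (inv x \<otimes> g')"
          using x g by (simp add: word_simps)
        also have "\<dots> = k" unfolding k(2) using x g subgroup_memD[OF K k(1)] 
          by (simp add: m_assoc word_simps)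
        finally show ?thesis using k by simp
      qed
      then have "g \<otimes> inv g' \<in> N" using g by (simp add: N_def)
      then have "h g \<otimes>\<^bsub>H\<^esub> inv\<^bsub>H\<^esub> h g' = \<one>\<^bsub>H\<^esub>" using H(2)[of "g \<otimes> inv g'"] g by simp
      then show ?thesis using g by (simp add: h.H.inv_solve_right' )
    qed
    then have "h g = h (inv_into (carrier G) F (F g))" if "g \<in> carrier G" for g
      using that by (metis f_inv_into_f image_eqI inv_into_into)
    then have "h ` carrier G \<subseteq> (h \<circ> inv_into (carrier G) F) ` (F ` carrier G)"
      by (auto simp: image_comp)
    ultimately show ?thesis by (meson finite_imageI finite_subset)
  qed
  ultimately show ?thesis using that[OF H(1)] H(2) h.surj by simp
qed

section \<open>Conjugacy classes and maximal subgroups in finite groups\<close>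

context group
begin

text \<open>Only \<open>S\<^sup>g \<subseteq> S\<close> is required; for finite \<open>S\<close> this implies \<open>S\<^sup>g = S\<close>, and the set is the normalizer of \<open>S\<close>.\<close>

definition normalizing :: "'a set \<Rightarrow> 'a set" where
  "normalizing S = {g \<in> carrier G. \<forall>s\<in>S. group_conj G s g \<in> S}"

lemma subgroup_normalizing:
  assumes "finite S" "S \<subseteq> carrier G"
  shows "subgroup (normalizing S) G"
proof (rule subgroupI)
  show "normalizing S \<subseteq> carrier G" by (auto simp: normalizing_def)
  have "\<one> \<in> normalizing S" using assms by (auto simp: normalizing_def)
  then show "normalizing S \<noteq> {}" by blast
next
  fix g assume g: "g \<in> normalizing S"
  then have gc: "g \<in> carrier G" by (simp add: normalizing_def)
  have inj: "inj_on (\<lambda>s. group_conj G s g) S"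
    using assms(2) gc by (intro inj_on_inverseI[where g = "\<lambda>s. group_conj G s (inv g)"]) auto
  have "(\<lambda>s. group_conj G s g) ` S \<subseteq> S" using g by (auto simp: normalizing_def)
  then have img: "(\<lambda>s. group_conj G s g) ` S = S" using endo_inj_surj[OF assms(1) _ inj] by blast
  have "group_conj G s (inv g) \<in> S" if s: "s \<in> S" for s
  proof -
    obtain u where "u \<in> S" "s = group_conj G u g" using img s by blast
    then show ?thesis using assms(2) gc by auto
  qed
  then show "inv g \<in> normalizing S" using gc by (simp add: normalizing_def)
next
  fix g h assume "g \<in> normalizing S" "h \<in> normalizing S"
  then show "g \<otimes> h \<in> normalizing S" using assms(2)
    by (auto simp: normalizing_def conj_conj[symmetric] subset_iff)
qed

definition maximal_subgroup :: "'a set \<Rightarrow> bool" where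
  "maximal_subgroup K \<longleftrightarrow> subgroup K G \<and> K \<noteq> carrier G \<and>
     (\<forall>L. subgroup L G \<longrightarrow> K \<subseteq> L \<longrightarrow> L = K \<or> L = carrier G)"

lemma maximal_subgroupD:
  assumes "maximal_subgroup K"
  shows "subgroup K G" "K \<noteq> carrier G"
    "\<And>L. subgroup L G \<Longrightarrow> K \<subseteq> L \<Longrightarrow> L \<noteq> carrier G \<Longrightarrow> L = K"
  using assms by (auto simp: maximal_subgroup_def)

lemma maximal_subgroup_subset_eq:
  "maximal_subgroup K \<Longrightarrow> maximal_subgroup L \<Longrightarrow> K \<subseteq> L \<Longrightarrow> K = L"
  by (auto simp: maximal_subgroup_def)

lemma maximal_subgroup_above:
  assumes fin: "finite (carrier G)" and L: "subgroup L G" "L \<noteq> carrier G"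
  obtains K where "maximal_subgroup K" "L \<subseteq> K"
proof -
  let ?P = "\<lambda>K. subgroup K G \<and> K \<noteq> carrier G \<and> L \<subseteq> K"
  have sub: "K \<subseteq> carrier G" if "?P K" for K using that subgroup.subset by blast
  have "\<forall>K. ?P K \<longrightarrow> card K < Suc (card (carrier G))"
    using card_mono[OF fin] sub by (simp add: less_Suc_eq_le)
  then obtain K where K: "?P K" and max: "\<And>K'. ?P K' \<Longrightarrow> card K' \<le> card K"
    using ex_has_greatest_nat[of ?P L card "Suc (card (carrier G))"] L by blast
  have "K' = K" if "subgroup K' G" "K \<subseteq> K'" "K' \<noteq> carrier G" for K'
    using max[of K'] that K sub[of K'] card_subset_eq[of K' K] card_mono[of K' K]
      finite_subset[OF _ fin] by (metis dual_order.antisym subset_trans)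
  then have "maximal_subgroup K" using K by (auto simp: maximal_subgroup_def)
  then show ?thesis using that K by blast
qed

lemma subgroup_conj_image:
  assumes K: "subgroup K G" and t: "t \<in> carrier G"
  shows "subgroup ((\<lambda>k. group_conj G k t) ` K) G"
proof -
  have "(\<lambda>k. group_conj G k t) \<in> hom G G" using t by (auto simp: hom_def conj_mult)
  then interpret group_hom G G "\<lambda>k. group_conj G k t" by unfold_locales
  show ?thesis by (rule subgroup_img_is_subgroup[OF K])
qed

lemma conj_image_carrier:
  assumes "t \<in> carrier G" shows "(\<lambda>k. group_conj G k t) ` carrier G = carrier G"
proof
  show "carrier G \<subseteq> (\<lambda>k. group_conj G k t) ` carrier G"
  proof
    fix y assume "y \<in> carrier G"
    then show "y \<in> (\<lambda>k. group_conj G k t) ` carrier G"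
      using assms by (intro image_eqI[of _ _ "group_conj G y (inv t)"]) auto
  qed
qed (use assms in auto)

lemma maximal_subgroup_conj:
  assumes K: "maximal_subgroup K" and t: "t \<in> carrier G"
  shows "maximal_subgroup ((\<lambda>k. group_conj G k t) ` K)"
proof -
  let ?c = "\<lambda>t k. group_conj G k t"
  note KD = maximal_subgroupD[OF K]
  have Kc: "K \<subseteq> carrier G" using KD(1) by (rule subgroup.subset)
  have cc: "?c (inv t) ` ?c t ` L = L" "?c t ` ?c (inv t) ` L = L" if "L \<subseteq> carrier G" for L
    using that t by (simp_all add: image_image subset_iff cong: image_cong_simp)
  have car: "?c (inv t) ` carrier G = carrier G"
    by (rule conj_image_carrier) (use t in simp)
  have neq: "?c t ` K \<noteq> carrier G"
    using cc(1)[OF Kc] car KD(2) by metis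
  have "L = ?c t ` K" if L: "subgroup L G" "?c t ` K \<subseteq> L" "L \<noteq> carrier G" for L
  proof -
    have Lc: "L \<subseteq> carrier G" using L(1) by (rule subgroup.subset)
    have "K \<subseteq> ?c (inv t) ` L" using image_mono[OF L(2), of "?c (inv t)"] cc(1)[OF Kc] by simp
    moreover have "?c (inv t) ` L \<noteq> carrier G"
    proof
      assume "?c (inv t) ` L = carrier G"
      then have "?c t ` carrier G = L" using cc(2)[OF Lc] by metis
      moreover have "?c t ` carrier G = carrier G" using car cc(2)[of "carrier G"] by simp
      ultimately show False using L(3) by simp
    qed
    ultimately have "?c (inv t) ` L = K"
      using KD(3) subgroup_conj_image[OF L(1), of "inv t"] t by simp
    then show ?thesis using cc(2)[OF Lc] by metis
  qed
  then show ?thesis using subgroup_conj_image[OF KD(1) t] neq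
    by (auto simp: maximal_subgroup_def)
qed

text \<open>
  A version of the normalizer condition for nilpotent groups, for subsets of a normal set \<open>c\<close>. The sets
  \<open>L\<^sub>i = (H \<inter> K) Z\<^sub>i(H)\<close> increase from \<open>H \<inter> K\<close> to a set containing \<open>c \<inter> H\<close>, and \<open>L\<^sub>i\<^sub>+\<^sub>1\<close> conjugates
  \<open>H \<inter> K\<close> into \<open>L\<^sub>i\<close>. At the first stage where \<open>L\<^sub>i\<^sub>+\<^sub>1\<close> meets \<open>c\<close> outside \<open>K\<close>, all of \<open>c \<inter> L\<^sub>i\<close> is still inside
  \<open>K\<close>, so an element of \<open>c\<close> found there normalizes \<open>c \<inter> H \<inter> K\<close>.
\<close>

lemma normalizer_grows:
  assumes H: "subgroup H G" and K: "subgroup K G" and c: "c \<subseteq> carrier G"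
    and inv: "\<And>y g. y \<in> c \<Longrightarrow> g \<in> carrier G \<Longrightarrow> group_conj G y g \<in> c"
    and nil: "c \<inter> H \<subseteq> rel_upper G H {\<one>} k" and out: "\<not> c \<inter> H \<subseteq> K"
  obtains x where "x \<in> c \<inter> H" "x \<notin> K" "x \<in> normalizing (c \<inter> H \<inter> K)"
proof -
  let ?Z = "rel_upper G H {\<one>}"
  define L where "L i = {l \<otimes> z |l z. l \<in> H \<inter> K \<and> z \<in> ?Z i}" for i
  have Hc: "\<And>x. x \<in> H \<Longrightarrow> x \<in> carrier G" using subgroup_memD[OF H] .
  have inv1: "invariant_subgroup G H {\<one>}" using invariant_subgroup_one subgroup.subset[OF H] by blast
  have Zinv: "invariant_subgroup G H (?Z i)" for i
    using invariant_subgroup_rel_upper[OF H inv1] .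
  have ZH: "?Z i \<subseteq> H" for i using rel_upper_subset[of "{\<one>}" H] subgroup.one_closed[OF H] by simp
  have "?Z k \<subseteq> L k"
  proof
    fix z assume z: "z \<in> ?Z k"
    then have "z = \<one> \<otimes> z" using ZH Hc by (simp add: subset_iff)
    moreover have "\<one> \<in> H \<inter> K" using subgroup.one_closed[OF H] subgroup.one_closed[OF K] by simp
    ultimately show "z \<in> L k" unfolding L_def using z by blast
  qed
  then have ex: "\<not> c \<inter> L k \<subseteq> K" using nil out by blast
  \<comment> \<open>the first stage that leaves \<open>K\<close> inside \<open>c\<close>; it is not stage 0, since \<open>L 0 = H \<inter> K\<close>\<close>
  define i where "i = (LEAST i. \<not> c \<inter> L i \<subseteq> K)"
  have i: "\<not> c \<inter> L i \<subseteq> K" using LeastI[of "\<lambda>i. \<not> c \<inter> L i \<subseteq> K", OF ex] by (simp add: i_def)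
  have "L 0 \<subseteq> K" using Hc by (auto simp: L_def)
  then obtain j where j: "i = Suc j" using i by (cases i) auto
  have below: "c \<inter> L j \<subseteq> K" using not_less_Least[of j "\<lambda>i. \<not> c \<inter> L i \<subseteq> K"] j by (auto simp: i_def)
  obtain x l z where x: "x \<in> c" "x \<notin> K" "x = l \<otimes> z" "l \<in> H \<inter> K" "z \<in> ?Z (Suc j)"
    using i unfolding j L_def by blast
  have zH: "z \<in> H" using x(5) by simp
  have lH: "l \<in> H" and lK: "l \<in> K" using x(4) by auto
  have xH: "x \<in> H" using x(3) lH zH subgroup.m_closed[OF H] by simp
  have "group_conj G s x \<in> c \<inter> H \<inter> K" if s: "s \<in> c \<inter> H \<inter> K" for s
  proof -
    have sH: "s \<in> H" and sK: "s \<in> K" using s by auto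
    define s' where "s' = group_conj G s l"
    have s': "s' \<in> H" "s' \<in> K"
      using subgroup_conj[OF H sH lH] subgroup_conj[OF K sK lK] by (simp_all add: s'_def)
    have "group_conj G s x = s' \<otimes> group_comm G s' z"
      using sH lH zH Hc by (simp add: s'_def x(3) word_simps)
    moreover have "group_comm G s' z \<in> ?Z j"
    proof -
      have "group_comm G z s' \<in> ?Z j" using x(5) s' by simp
      then show ?thesis using comm_swap[of z s'] Hc[OF zH] Hc[OF s'(1)]
        subgroup.m_inv_closed[OF invariant_subgroupD(1)[OF Zinv]] by simp
    qed
    ultimately have "group_conj G s x \<in> L j" using s' unfolding L_def by blast
    moreover have "group_conj G s x \<in> c" using inv s Hc[OF xH] by blast
    moreover have "group_conj G s x \<in> H" using subgroup_conj[OF H sH xH] .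
    ultimately show ?thesis using below by blast
  qed
  then have "x \<in> normalizing (c \<inter> H \<inter> K)" using Hc[OF xH] by (simp add: normalizing_def)
  then show ?thesis using that x xH by blast
qed

text \<open>Suppose that distinct maximal subgroups \<open>A\<close> and \<open>B\<close> share elements of \<open>c\<close>, and choose them so that
  \<open>S = c \<inter> A \<inter> B\<close> is as large as possible. If \<open>c \<inter> A\<close> is not contained in \<open>B\<close>, then some element of
  \<open>c \<inter> A\<close> outside \<open>B\<close> normalizes \<open>S\<close>, and so does \<open>A \<inter> B\<close>; a maximal subgroup above the normalizer of \<open>S\<close>
  thus shares more of \<open>c\<close> with \<open>A\<close> than \<open>B\<close> does and must be \<open>A\<close> itself. But \<open>B\<close> contributes to this
  normalizer something outside \<open>A\<close>: an element of \<open>c\<close> if \<open>c \<inter> B\<close> is not contained in \<open>A\<close>, and all of \<open>B\<close>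
  otherwise. Therefore \<open>c \<inter> A = S = c \<inter> B\<close> is normalized by the distinct maximal subgroups \<open>A\<close> and \<open>B\<close>, hence
  normal, hence all of \<open>c\<close>, although \<open>c\<close> lies in no proper subgroup.\<close>

lemma maximal_subgroups_disjoint_traces:
  assumes fin: "finite (carrier G)" and c: "c \<subseteq> carrier G"
    and inv: "\<And>y g. y \<in> c \<Longrightarrow> g \<in> carrier G \<Longrightarrow> group_conj G y g \<in> c"
    and trans: "\<And>S. S \<subseteq> c \<Longrightarrow> S \<noteq> {} \<Longrightarrow> normalizing S = carrier G \<Longrightarrow> S = c"
    and big: "\<And>L. subgroup L G \<Longrightarrow> c \<subseteq> L \<Longrightarrow> L = carrier G"
    and nil: "\<And>H. subgroup H G \<Longrightarrow> H \<noteq> carrier G \<Longrightarrow> \<exists>k. c \<inter> H \<subseteq> rel_upper G H {\<one>} k"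
    and H: "maximal_subgroup H" and K: "maximal_subgroup K" and ne: "c \<inter> H \<inter> K \<noteq> {}"
  shows "H = K"
proof (rule ccontr)
  assume "H \<noteq> K"
  let ?P = "\<lambda>(H, K). maximal_subgroup H \<and> maximal_subgroup K \<and> c \<inter> H \<inter> K \<noteq> {} \<and> H \<noteq> K"
  let ?f = "\<lambda>(H, K). card (c \<inter> H \<inter> K)"
  have finc: "finite c" using c fin finite_subset by blast
  have bound: "\<forall>p. ?P p \<longrightarrow> ?f p < Suc (card c)"
    using finc by (auto simp: less_Suc_eq_le intro!: card_mono)
  have PHK: "?P (H, K)" using H K ne \<open>H \<noteq> K\<close> by simp
  \<comment> \<open>the extremal pair of maximal subgroups\<close>
  obtain p where p: "?P p" "\<forall>q. ?P q \<longrightarrow> ?f q \<le> ?f p"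
    using ex_has_greatest_nat[OF PHK bound] by blast
  obtain A B where AB: "p = (A, B)" by (cases p)
  have one_side: "c \<inter> A \<subseteq> B" 
    if A: "maximal_subgroup A" and B: "maximal_subgroup B" and AB: "c \<inter> A \<inter> B \<noteq> {}" "A \<noteq> B"
      and best: "\<forall>q. ?P q \<longrightarrow> ?f q \<le> card (c \<inter> A \<inter> B)" for A B
  proof (rule ccontr)
    assume nsub: "\<not> c \<inter> A \<subseteq> B"
    let ?S = "c \<inter> A \<inter> B"
    note AD = maximal_subgroupD[OF A] and BD = maximal_subgroupD[OF B]
    have Ac: "A \<subseteq> carrier G" using AD(1) by (rule subgroup.subset)
    have finS: "finite ?S" using finc by auto
    have Sc: "?S \<subseteq> carrier G" using c by blast
    have N: "subgroup (normalizing ?S) G" using subgroup_normalizing[OF finS Sc] .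
    have "normalizing ?S \<noteq> carrier G"
    proof
      assume "normalizing ?S = carrier G"
      then have "?S = c" using trans[of ?S] AB(1) by blast
      then have "A = carrier G" using big[OF AD(1)] by blast
      then show False using AD(2) by simp
    qed
    then obtain L where L: "maximal_subgroup L" "normalizing ?S \<subseteq> L"
      using maximal_subgroup_above[OF fin N] by blast
    have SN: "A \<inter> B \<subseteq> normalizing ?S"
      using inv subgroup_conj[OF AD(1)] subgroup_conj[OF BD(1)] Ac by (auto simp: normalizing_def)
    obtain k where k: "c \<inter> A \<subseteq> rel_upper G A {\<one>} k" using nil[OF AD(1,2)] by blast
    obtain x where x: "x \<in> c \<inter> A" "x \<notin> B" "x \<in> normalizing ?S"
      using normalizer_grows[OF AD(1) BD(1) c inv k nsub] by blast
    have LA: "L = A"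
    proof (rule ccontr)
      assume "L \<noteq> A"
      have sub: "insert x ?S \<subseteq> c \<inter> L \<inter> A" using x L(2) SN by auto
      have "?P (L, A)" using L(1) A \<open>L \<noteq> A\<close> sub by auto
      then have "card (c \<inter> L \<inter> A) \<le> card ?S" using best[rule_format, of "(L, A)"] by simp
      moreover have "card (insert x ?S) \<le> card (c \<inter> L \<inter> A)"
        by (rule card_mono[OF _ sub]) (use finc in simp)
      moreover have "x \<notin> ?S" using x by blast
      ultimately show False using finS by simp
    qed
    show False
    proof (cases "c \<inter> B \<subseteq> A")
      case True
      then have "?S = c \<inter> B" by blast
      then have "B \<subseteq> normalizing ?S" 
        using inv subgroup_conj[OF BD(1)] subgroup.subset[OF BD(1)] by (auto simp: normalizing_def)
      then have "B \<subseteq> A" using L(2) LA by blast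
      then show False using maximal_subgroup_subset_eq[OF B A] AB(2) by simp
    next
      case False
      have eq: "c \<inter> B \<inter> A = ?S" by blast
      obtain k where k: "c \<inter> B \<subseteq> rel_upper G B {\<one>} k" using nil[OF BD(1,2)] by blast
      obtain y where "y \<in> c \<inter> B" "y \<notin> A" "y \<in> normalizing ?S"
        using normalizer_grows[OF BD(1) AD(1) c inv k False] unfolding eq by blast
      then show False using L(2) LA by blast
    qed
  qed
  have A: "maximal_subgroup A" and B: "maximal_subgroup B" and neAB: "c \<inter> A \<inter> B \<noteq> {}" "A \<noteq> B"
    and best: "\<forall>q. ?P q \<longrightarrow> ?f q \<le> card (c \<inter> A \<inter> B)"
    using p by (auto simp: AB)
  have swap: "c \<inter> B \<inter> A = c \<inter> A \<inter> B" by blast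
  have "c \<inter> A \<subseteq> B" using one_side[OF A B neAB best] .
  moreover have "c \<inter> B \<subseteq> A"
    using one_side[OF B A] neAB best unfolding swap by blast
  ultimately have S: "c \<inter> A = c \<inter> B" by blast
  note AD = maximal_subgroupD[OF A] and BD = maximal_subgroupD[OF B]
  have "finite (c \<inter> A)" "c \<inter> A \<subseteq> carrier G" using finc c by auto
  then have N: "subgroup (normalizing (c \<inter> A)) G" by (rule subgroup_normalizing)
  have "A \<subseteq> normalizing (c \<inter> A)"
    using inv subgroup_conj[OF AD(1)] subgroup.subset[OF AD(1)] by (auto simp: normalizing_def)
  moreover have "B \<subseteq> normalizing (c \<inter> A)" unfolding S
    using inv subgroup_conj[OF BD(1)] subgroup.subset[OF BD(1)] by (auto simp: normalizing_def)
  ultimately have "normalizing (c \<inter> A) = carrier G"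
    using AD(3)[OF N] BD(3)[OF N] neAB(2) by blast
  then have "c \<inter> A = c" using trans[of "c \<inter> A"] neAB(1) by blast
  then have "A = carrier G" using big[OF AD(1)] by blast
  then show False using AD(2) by simp
qed

text \<open>If \<open>[t, y]\<close> and \<open>y\<close> lie in \<open>K\<close>, then so does \<open>y\<^sup>t\<close>, because \<open>[t, y] = (y\<^sup>t)\<inverse> y\<close>. The closure
  hypothesis on \<open>K\<close> turns this into \<open>t \<in> K\<close>, and so removes the commutators one after the other.\<close>

lemma engel_descends_to_self_normalizing:
  assumes K: "subgroup K G" and y: "y \<in> K" and x: "x \<in> carrier G"
    and closed: "\<And>t. t \<in> carrier G \<Longrightarrow> group_conj G y t \<in> K \<Longrightarrow> t \<in> K"
    and engel: "engel_comm G x m y \<in> K"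
  shows "x \<in> K"
  using engel
proof (induction m)
  case (Suc m)
  let ?t = "engel_comm G x m y"
  have yc: "y \<in> carrier G" using subgroup_memD[OF K y] .
  have tc: "?t \<in> carrier G" using x yc by simp
  have "group_conj G y ?t = y \<otimes> inv (group_comm G ?t y)"
    using tc yc by (simp add: word_simps)
  also have "\<dots> \<in> K"
    using Suc.prems y by (simp add: subgroup.m_closed[OF K] subgroup.m_inv_closed[OF K])
  finally show ?case using Suc.IH closed[OF tc] by blast
qed simp

definition conj_class :: "'a \<Rightarrow> 'a set" where
  "conj_class a = group_conj G a ` carrier G"

lemma conj_class_subset: "a \<in> carrier G \<Longrightarrow> conj_class a \<subseteq> carrier G"
  by (auto simp: conj_class_def)

lemma conj_class_self: "a \<in> carrier G \<Longrightarrow> a \<in> conj_class a"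
  unfolding conj_class_def by (rule image_eqI[of _ _ "\<one>"]) auto

lemma conj_class_conj:
  "a \<in> carrier G \<Longrightarrow> y \<in> conj_class a \<Longrightarrow> g \<in> carrier G \<Longrightarrow> group_conj G y g \<in> conj_class a"
  by (auto simp: conj_class_def conj_conj)

lemma conj_class_trans:
  assumes "a \<in> carrier G" "S \<subseteq> conj_class a" "S \<noteq> {}" "normalizing S = carrier G"
  shows "S = conj_class a"
proof
  show "conj_class a \<subseteq> S"
  proof
    fix z assume "z \<in> conj_class a"
    then obtain h where h: "h \<in> carrier G" "z = group_conj G a h" by (auto simp: conj_class_def)
    obtain g where g: "g \<in> carrier G" "group_conj G a g \<in> S"
      using assms(2,3) by (auto simp: conj_class_def)
    have "inv g \<otimes> h \<in> normalizing S" using g h assms(4) by simp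
    then have "group_conj G (group_conj G a g) (inv g \<otimes> h) \<in> S"
      using g(2) unfolding normalizing_def by blast
    then show "z \<in> S" using g h assms(1) by (simp add: conj_conj inv_cancel_left')
  qed
qed fact

lemma subgroup_commuting:
  assumes "a \<in> carrier G" shows "subgroup {g \<in> carrier G. a \<otimes> g = g \<otimes> a} G"
proof (rule subgroupI)
  have "\<one> \<in> {g \<in> carrier G. a \<otimes> g = g \<otimes> a}" using assms by simp
  then show "{g \<in> carrier G. a \<otimes> g = g \<otimes> a} \<noteq> {}" by blast
next
  fix g assume "g \<in> {g \<in> carrier G. a \<otimes> g = g \<otimes> a}"
  then have g: "g \<in> carrier G" "a \<otimes> g = g \<otimes> a" by auto
  have "inv g \<otimes> a = inv g \<otimes> (a \<otimes> g) \<otimes> inv g" using g(1) assms by (simp add: m_assoc)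
  also have "\<dots> = a \<otimes> inv g" unfolding g(2) using g(1) assms by (simp add: inv_cancel_left)
  finally show "inv g \<in> {g \<in> carrier G. a \<otimes> g = g \<otimes> a}" using g by simp
next
  fix g h assume "g \<in> {g \<in> carrier G. a \<otimes> g = g \<otimes> a}" "h \<in> {g \<in> carrier G. a \<otimes> g = g \<otimes> a}"
  then show "g \<otimes> h \<in> {g \<in> carrier G. a \<otimes> g = g \<otimes> a}" using assms by auto (metis m_assoc)
qed auto

text \<open>Assume that the class of \<open>a\<close> lies in no proper subgroup. As \<open>a\<close> is not central, every conjugate of \<open>a\<close>
  lies in a maximal subgroup, and this maximal subgroup is unique by \<open>maximal_subgroups_disjoint_traces\<close>. Let \<open>H\<close> be the one containing \<open>a\<close>, let \<open>y\<close> be a conjugate outside \<open>H\<close> and \<open>K\<close> the maximal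
  subgroup containing \<open>y\<close>. If \<open>y\<^sup>t \<in> K\<close>, then \<open>K\<close> and \<open>K\<^sup>t\<close> share the conjugate \<open>y\<^sup>t\<close>, so \<open>K = K\<^sup>t\<close> and
  \<open>t \<in> K\<close> since \<open>K\<close> is its own normalizer. So \<open>[a, y, \<dots>, y] = 1 \<in> K\<close> yields \<open>a \<in> K\<close>, that is \<open>K = H\<close>, which
  is absurd.\<close>

lemma engel_conj_class_in_proper_subgroup:
  assumes fin: "finite (carrier G)" and a: "a \<in> carrier G"
    and engel: "\<And>g. g \<in> carrier G \<Longrightarrow> \<exists>m. engel_comm G a m g = \<one>"
    and nil: "\<And>H. subgroup H G \<Longrightarrow> H \<noteq> carrier G \<Longrightarrow> \<exists>k. conj_class a \<inter> H \<subseteq> rel_upper G H {\<one>} k"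
    and noncentral: "\<exists>g\<in>carrier G. a \<otimes> g \<noteq> g \<otimes> a"
  obtains Y where "subgroup Y G" "Y \<noteq> carrier G" "conj_class a \<subseteq> Y"
proof (rule ccontr)
  assume "\<not> thesis"
  then have big: "L = carrier G" if "subgroup L G" "conj_class a \<subseteq> L" for L
    using that \<open>\<And>Y. subgroup Y G \<Longrightarrow> Y \<noteq> carrier G \<Longrightarrow> conj_class a \<subseteq> Y \<Longrightarrow> thesis\<close> by blast
  let ?c = "conj_class a"
  have cc: "?c \<subseteq> carrier G" using conj_class_subset[OF a] .
  have traces: "H = K" 
    if "maximal_subgroup H" "maximal_subgroup K" "?c \<inter> H \<inter> K \<noteq> {}" for H K
    by (rule maximal_subgroups_disjoint_traces[OF fin cc conj_class_conj[OF a] conj_class_trans[OF a] big nil that])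
  \<comment> \<open>the centralizer of a conjugate is proper because \<open>a\<close> is not central\<close>
  have max_above: "\<exists>K. maximal_subgroup K \<and> y \<in> K" if y: "y \<in> ?c" for y
  proof -
    let ?C = "{g \<in> carrier G. y \<otimes> g = g \<otimes> y}"
    have yc: "y \<in> carrier G" using y cc by blast
    have "?C \<noteq> carrier G"
    proof
      assume "?C = carrier G"
      then have comm: "y \<otimes> g = g \<otimes> y" if "g \<in> carrier G" for g using that by blast
      obtain g where g: "g \<in> carrier G" "y = group_conj G a g" using y by (auto simp: conj_class_def)
      have "a = group_conj G y (inv g)" using g a by simp
      also have "\<dots> = y" using comm[of "inv g"] g(1) yc by (simp add: group_conj_def m_assoc inv_cancel_left')
      finally show False using comm noncentral by auto
    qed
    then obtain K where "maximal_subgroup K" "?C \<subseteq> K"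
      using maximal_subgroup_above[OF fin subgroup_commuting[OF yc]] by blast
    then show ?thesis using yc by blast
  qed
  obtain H where H: "maximal_subgroup H" "a \<in> H" using max_above[OF conj_class_self[OF a]] by blast
  have "\<not> ?c \<subseteq> H" using big maximal_subgroupD(1,2)[OF H(1)] by blast
  then obtain y where y: "y \<in> ?c" "y \<notin> H" by blast
  obtain K where K: "maximal_subgroup K" "y \<in> K" using max_above[OF y(1)] by blast
  note KD = maximal_subgroupD[OF K(1)]
  have Kc: "K \<subseteq> carrier G" using KD(1) by (rule subgroup.subset)
  have yc: "y \<in> carrier G" using y(1) cc by blast
  have N: "subgroup (normalizing K) G" 
    using subgroup_normalizing[OF finite_subset[OF Kc fin] Kc] .
  have KN: "K \<subseteq> normalizing K" using subgroup_conj[OF KD(1)] Kc by (auto simp: normalizing_def)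
  have "normalizing K \<noteq> carrier G"
  proof
    assume "normalizing K = carrier G"
    then have nK: "g \<in> normalizing K" if "g \<in> carrier G" for g using that by simp
    have "?c \<subseteq> K"
    proof
      fix z assume "z \<in> ?c"
      then obtain h where h: "h \<in> carrier G" "z = group_conj G a h" by (auto simp: conj_class_def)
      obtain g where g: "g \<in> carrier G" "y = group_conj G a g" using y by (auto simp: conj_class_def)
      have "group_conj G y (inv g \<otimes> h) \<in> K" using nK[of "inv g \<otimes> h"] g h K(2) by (auto simp: normalizing_def)
      then show "z \<in> K" using g h a by (simp add: conj_conj inv_cancel_left')
    qed
    then show False using big[OF KD(1)] KD(2) by blast
  qed
  then have NK: "normalizing K = K" using KD(3)[OF N KN] by blast
  have closed: "t \<in> K" if t: "t \<in> carrier G" "group_conj G y t \<in> K" for t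
  proof -
    have "group_conj G y t \<in> ?c \<inter> (\<lambda>k. group_conj G k t) ` K \<inter> K"
      using t K(2) conj_class_conj[OF a y(1)] by blast
    then have "(\<lambda>k. group_conj G k t) ` K = K"
      using traces[OF maximal_subgroup_conj[OF K(1) t(1)] K(1)] by blast
    then have "t \<in> normalizing K" using t(1) by (auto simp: normalizing_def)
    then show ?thesis using NK by simp
  qed
  obtain m where "engel_comm G a m y = \<one>" using engel[OF yc] by blast
  then have "engel_comm G a m y \<in> K" using subgroup.one_closed[OF KD(1)] by simp
  then have "a \<in> K" using engel_descends_to_self_normalizing[OF KD(1) K(2) a closed] by blast
  then have "H = K" using traces[OF H(1) K(1)] H(2) conj_class_self[OF a] by blast
  then show False using y(2) K(2) by simp
qed

end

section \<open>Right Engel elements of finite groups\<close>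

context group
begin

subsection \<open>Coprime action\<close>

lemma comm_pow_right:
  assumes x: "x \<in> carrier G" and g: "g \<in> carrier G"
    and c: "group_comm G x g \<otimes> g = g \<otimes> group_comm G x g"
  shows "group_comm G x (g [^] (n::nat)) = group_comm G x g [^] n"
proof (induction n)
  case 0
  then show ?case using x by (simp add: word_simps)
next
  case (Suc n)
  let ?c = "group_comm G x g"
  have gn: "g [^] n \<in> carrier G" using g by simp
  have "group_comm G x (g [^] Suc n) = ?c \<otimes> group_conj G (group_comm G x (g [^] n)) g"
    using x g gn by (simp add: word_simps)
  also have "group_comm G x (g [^] n) = ?c [^] n" by (rule Suc.IH)
  also have "group_conj G (?c [^] n) g = ?c [^] n"
  proof -
    have "?c [^] n \<otimes> g = g \<otimes> ?c [^] n"
      using group_commutes_pow[OF c, of n] x g by simp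
    then show ?thesis using x g by (simp add: group_conj_def m_assoc inv_cancel_left)
  qed
  finally show ?case using x g by (simp only: nat_pow_Suc2 comm_closed)
qed

lemma comm_pow_left:
  assumes x: "x \<in> carrier G" and g: "g \<in> carrier G"
    and c: "group_comm G x g \<otimes> x = x \<otimes> group_comm G x g"
  shows "group_comm G (x [^] (n::nat)) g = group_comm G x g [^] n"
proof (induction n)
  case 0
  then show ?case using g by simp
next
  case (Suc n)
  let ?c = "group_comm G x g"
  have xn: "x [^] n \<in> carrier G" using x by simp
  have "group_comm G (x [^] Suc n) g = group_conj G (group_comm G (x [^] n) g) x \<otimes> ?c"
    using x g xn by (simp add: comm_mult_left)
  also have "group_comm G (x [^] n) g = ?c [^] n" by (rule Suc.IH)
  also have "group_conj G (?c [^] n) x = ?c [^] n"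
  proof -
    have "?c [^] n \<otimes> x = x \<otimes> ?c [^] n"
      using group_commutes_pow[OF c, of n] x g by simp
    then show ?thesis using x g by (simp add: group_conj_def m_assoc inv_cancel_left)
  qed
  finally show ?case by simp
qed

text \<open>If \<open>b\<close> and \<open>c = [b, g]\<close> are consecutive entries of the Engel sequence of \<open>x\<close> and \<open>c\<close> commutes with \<open>g\<close>, then
  \<open>1 = [b, g\<^sup>r] = c\<^sup>r\<close>, so \<open>c = 1\<close> as \<open>T\<close> has no other element of order dividing \<open>r\<close>. Hence the sequence
  can only end at its first commutator.\<close>

lemma engel_coprime_commute:
  assumes x: "x \<in> carrier G" and g: "g \<in> carrier G" and r: "g [^] (r::nat) = \<one>"
    and engel: "engel_comm G x n g = \<one>"
    and T: "\<And>m. engel_comm G x (Suc m) g \<in> T" and tf: "\<And>t. t \<in> T \<Longrightarrow> t [^] r = \<one> \<Longrightarrow> t = \<one>"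
  shows "group_comm G x g = \<one>"
proof -
  have "engel_comm G x (Suc m) g = \<one> \<Longrightarrow> engel_comm G x (Suc 0) g = \<one>" for m
  proof (induction m)
    case (Suc m)
    let ?b = "engel_comm G x m g"
    have b: "?b \<in> carrier G" using x g by simp
    have c: "group_comm G ?b g \<in> carrier G" using b g by simp
    have "group_comm G ?b g \<otimes> g = g \<otimes> group_comm G ?b g"
      using Suc.prems comm_eq_one_iff[OF c g] by simp
    then have "group_comm G ?b (g [^] r) = group_comm G ?b g [^] r"
      by (rule comm_pow_right[OF b g])
    then have "group_comm G ?b g [^] r = \<one>" using b by (simp add: r word_simps)
    then have "group_comm G ?b g = \<one>" using tf T[of m] by simp
    then show ?case using Suc.IH by simp
  qed simp
  moreover have "engel_comm G x (Suc n) g = \<one>" using engel g by simp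
  ultimately show ?thesis by simp
qed

lemma pow_coprime_eq_one:
  assumes "x \<in> carrier G" "x [^] (m::nat) = \<one>" "x [^] (n::nat) = \<one>" "coprime m n"
  shows "x = \<one>"
proof -
  have "ord x dvd 1" using assms pow_eq_id[of x] coprime_common_divisor by blast
  then show ?thesis using assms(1) ord_eq_1 by auto
qed

subsection \<open>Central elements from the class equation\<close>

lemma orbit_conjugation:
  assumes "x \<in> carrier G"
  shows "orbit G (\<lambda>g. \<lambda>h\<in>carrier G. g \<otimes> h \<otimes> inv g) x = {g \<otimes> x \<otimes> inv g |g. g \<in> carrier G}"
  using assms by (auto simp: orbit_def)

lemma stabilizer_conjugation:
  assumes "x \<in> carrier G"
  shows "stabilizer G (\<lambda>g. \<lambda>h\<in>carrier G. g \<otimes> h \<otimes> inv g) x = {g \<in> carrier G. x \<otimes> g = g \<otimes> x}"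
proof -
  have "g \<otimes> x \<otimes> inv g = x \<longleftrightarrow> x \<otimes> g = g \<otimes> x" if g: "g \<in> carrier G" for g
    using inv_solve_right'[of x "g \<otimes> x" g] g assms by auto
  then show ?thesis using assms by (auto simp: stabilizer_def)
qed

text \<open>For \<open>q \<noteq> p\<close> a Sylow \<open>q\<close>-subgroup consists of elements of order prime to \<open>p\<close>, so it lies in \<open>C\<close>, and the
  index of \<open>C\<close> is prime to \<open>q\<close>.\<close>

lemma prime_not_dvd_index:
  assumes fin: "finite (carrier G)" and p: "Factorial_Ring.prime p" and q: "Factorial_Ring.prime q" "q \<noteq> p"
    and C: "subgroup C G" "k * card C = order G"
    and p': "\<And>g r. g \<in> carrier G \<Longrightarrow> coprime r p \<Longrightarrow> g [^] (r::nat) = \<one> \<Longrightarrow> g \<in> C"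
  shows "\<not> q dvd k"
proof
  assume "q dvd k"
  have o0: "order G \<noteq> 0" using fin order_gt_0_iff_finite by simp
  obtain m where m: "order G = q ^ multiplicity q (order G) * m"
    using multiplicity_dvd[of q "order G"] by (elim dvdE)
  let ?t = "multiplicity q (order G)"
  obtain Q where Q: "subgroup Q G" "card Q = q ^ ?t"
    using sylow_thm[OF q(1) group_axioms m fin] by blast
  have "Q \<subseteq> C"
  proof
    fix g assume g: "g \<in> Q"
    have gc: "g \<in> carrier G" using subgroup_memD[OF Q(1) g] .
    interpret Q: group "G\<lparr>carrier := Q\<rparr>" using subgroup_imp_group[OF Q(1)] .
    have "g [^]\<^bsub>G\<lparr>carrier := Q\<rparr>\<^esub> order (G\<lparr>carrier := Q\<rparr>) = \<one>\<^bsub>G\<lparr>carrier := Q\<rparr>\<^esub>"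
      using Q.pow_order_eq_1[of g] g by simp
    then have "g [^] (q ^ ?t) = \<one>" using Q(2) by (simp add: order_def flip: nat_pow_consistent)
    moreover have "coprime (q ^ ?t) p" using primes_coprime[OF q(1) p q(2)] by simp
    ultimately show "g \<in> C" using p' gc by blast
  qed
  then have "subgroup Q (G\<lparr>carrier := C\<rparr>)" using subgroup_incl[OF Q(1) C(1)] by simp
  then have "card (rcosets\<^bsub>G\<lparr>carrier := C\<rparr>\<^esub> Q) * card Q = card C"
    using group.lagrange[OF subgroup_imp_group[OF C(1)]] by (simp add: order_def)
  then have "card Q dvd card C" by (metis dvd_triv_right)
  then have "q * card Q dvd k * card C" using \<open>q dvd k\<close> by (simp add: mult_dvd_mono)
  then have "q ^ Suc ?t dvd order G" using Q(2) C(2) by simp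
  moreover have "\<not> is_unit q" using q(1) not_prime_unit by blast
  ultimately have "Suc ?t \<le> ?t" using o0 power_dvd_iff_le_multiplicity by blast
  then show False by simp
qed

text \<open>The class equation for the conjugation action on \<open>M\<close>: the centralizer of each element of \<open>M\<close> contains all
  elements of order prime to \<open>p\<close>, so the size of its class is a power of \<open>p\<close>. As \<open>p\<close> divides the order of
  \<open>M\<close>, it divides the number of one-element classes; the class of the identity is one of them, so there
  are others.\<close>

lemma nontrivial_central_element:
  assumes fin: "finite (carrier G)" and p: "Factorial_Ring.prime p"
    and M: "invariant_subgroup G (carrier G) M" and pM: "p dvd card M"
    and p': "\<And>x g r. x \<in> M \<Longrightarrow> g \<in> carrier G \<Longrightarrow> coprime r p \<Longrightarrow> g [^] (r::nat) = \<one> \<Longrightarrow> x \<otimes> g = g \<otimes> x"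
  obtains z where "z \<in> M" "z \<noteq> \<one>" "\<And>g. g \<in> carrier G \<Longrightarrow> z \<otimes> g = g \<otimes> z"
proof -
  define F where "F = {z \<in> M. \<forall>g\<in>carrier G. z \<otimes> g = g \<otimes> z}"
  let ?\<phi> = "\<lambda>g. \<lambda>h\<in>carrier G. g \<otimes> h \<otimes> inv g"
  interpret act: group_action G "carrier G" ?\<phi> by (rule action_by_conjugation)
  note MD = invariant_subgroupD[OF M]
  have Mc: "M \<subseteq> carrier G" using MD(1) by (rule subgroup.subset)
  have finM: "finite M" using Mc fin finite_subset by blast
  have orb_M: "orbit G ?\<phi> x \<subseteq> M - F" if x: "x \<in> M - F" for x
  proof
    fix y assume "y \<in> orbit G ?\<phi> x"
    then obtain g where g: "g \<in> carrier G" "y = g \<otimes> x \<otimes> inv g"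
      using orbit_conjugation[of x] x Mc by auto
    have xc: "x \<in> carrier G" using x Mc by blast
    have y: "y = group_conj G x (inv g)" using g by (simp add: group_conj_def)
    have "y \<in> M" using MD(2)[of "inv g" x] g(1) x y by simp
    moreover have "y \<notin> F"
    proof
      assume "y \<in> F"
      then have "y \<otimes> g = g \<otimes> y" using g(1) by (simp add: F_def)
      then have "x = y" using g xc by (simp add: m_assoc)
      then show False using \<open>y \<in> F\<close> x by simp
    qed
    ultimately show "y \<in> M - F" by simp
  qed
  have p_orb: "p dvd card (orbit G ?\<phi> x)" if x: "x \<in> M - F" for x
  proof -
    have xc: "x \<in> carrier G" using x Mc by blast
    let ?k = "card (orbit G ?\<phi> x)"
    have eq: "?k * card (stabilizer G ?\<phi> x) = order G" using act.orbit_stabilizer_theorem[OF xc] .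
    have C: "subgroup (stabilizer G ?\<phi> x) G" using act.stabilizer_subgroup[OF xc] .
    have "\<not> q dvd ?k" if "Factorial_Ring.prime q" "q \<noteq> p" for q
      by (rule prime_not_dvd_index[OF fin p that C eq])
        (use p'[of x] x stabilizer_conjugation[OF xc] in simp)
    moreover have "?k \<noteq> 1"
    proof
      assume "?k = 1"
      then obtain y where "orbit G ?\<phi> x = {y}" by (auto simp: card_1_singleton_iff)
      then have o: "orbit G ?\<phi> x = {x}" using act.orbit_refl[OF xc] by simp
      have "x \<otimes> g = g \<otimes> x" if g: "g \<in> carrier G" for g
      proof -
        have "g \<otimes> x \<otimes> inv g = x" using o g unfolding orbit_conjugation[OF xc] by blast
        then show ?thesis using g xc by (metis inv_solve_right' m_closed)
      qed
      then show False using x by (simp add: F_def)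
    qed
    ultimately show ?thesis using prime_factor_nat[of ?k] by blast
  qed
  have "p dvd card (\<Union> ((orbit G ?\<phi>) ` (M - F)))"
  proof (rule dvd_partition)
    show "finite (\<Union> ((orbit G ?\<phi>) ` (M - F)))"
      using finite_subset[OF _ finM] orb_M by blast
    show "\<forall>c\<in>(orbit G ?\<phi>) ` (M - F). p dvd card c" using p_orb by blast
    show "\<forall>c1\<in>(orbit G ?\<phi>) ` (M - F). \<forall>c2\<in>(orbit G ?\<phi>) ` (M - F). c1 \<noteq> c2 \<longrightarrow> c1 \<inter> c2 = {}"
    proof (intro ballI impI)
      fix c1 c2 assume c: "c1 \<in> (orbit G ?\<phi>) ` (M - F)" "c2 \<in> (orbit G ?\<phi>) ` (M - F)" "c1 \<noteq> c2"
      have "(orbit G ?\<phi>) ` (M - F) \<subseteq> orbits G (carrier G) ?\<phi>" using Mc unfolding orbits_def by blast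
      then show "c1 \<inter> c2 = {}" using act.disjoint_union[of c1 c2] c by blast
    qed
  qed
  moreover have "\<Union> ((orbit G ?\<phi>) ` (M - F)) = M - F"
    using orb_M act.orbit_refl Mc by blast
  ultimately have "p dvd card (M - F)" by simp
  moreover have "F \<subseteq> M" by (auto simp: F_def)
  then have "card M = card (M - F) + card F"
    using finM by (metis add.commute card_Diff_subset card_mono finite_subset le_add_diff_inverse)
  ultimately have "p dvd card F" using pM by (metis dvd_add_right_iff)
  moreover have oneF: "\<one> \<in> F" using subgroup.one_closed[OF MD(1)] by (simp add: F_def)
  moreover have finF: "finite F" using \<open>F \<subseteq> M\<close> finM finite_subset by blast
  ultimately have "card F \<ge> 2" using prime_ge_2_nat[OF p] 
    by (metis card_gt_0_iff dvd_imp_le empty_iff le_trans)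
  then have "F \<noteq> {\<one>}" by auto
  then obtain z where "z \<in> F" "z \<noteq> \<one>" using oneF by blast
  then show ?thesis using that by (auto simp: F_def)
qed

subsection \<open>Baer's theorem\<close>

lemma comm_consistent:
  "subgroup Y G \<Longrightarrow> x \<in> Y \<Longrightarrow> y \<in> Y \<Longrightarrow> group_comm (G\<lparr>carrier := Y\<rparr>) x y = group_comm G x y"
  by (simp add: group_comm_def group_conj_def)

lemma engel_consistent:
  assumes "subgroup Y G" "x \<in> Y" "y \<in> Y"
  shows "engel_comm (G\<lparr>carrier := Y\<rparr>) x m y = engel_comm G x m y \<and> engel_comm G x m y \<in> Y"
  using assms by (induction m) (auto simp: comm_consistent subgroup_comm)

lemma rel_upper_consistent:
  assumes "subgroup Y G"
  shows "rel_upper (G\<lparr>carrier := Y\<rparr>) Y N k = rel_upper G Y N k"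
  by (induction k) (auto simp: comm_consistent[OF assms])

lemma rel_upper_center:
  assumes "Y \<subseteq> carrier G"
  shows "rel_upper G Y {\<one>} (Suc 0) = {z \<in> Y. \<forall>g\<in>Y. z \<otimes> g = g \<otimes> z}"
  using assms by (auto simp: comm_eq_one_iff subset_iff)

lemma normal_rel_upper_mono:
  assumes "N \<lhd> G" "j \<le> k"
  shows "rel_upper G (carrier G) N j \<subseteq> rel_upper G (carrier G) N k"
proof (rule rel_upper_mono[OF subgroup_self _ _ assms(2)])
  show "invariant_subgroup G (carrier G) N" using assms(1) by (simp add: normal_iff_invariant)
  show "N \<subseteq> carrier G" using assms(1) by (simp add: normal_imp_subgroup subgroup.subset)
qed

lemma finite_subset_rel_upper:
  assumes Y: "subgroup Y G" and N: "invariant_subgroup G Y N" "N \<subseteq> Y" and fin: "finite T"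
    and mem: "\<And>t. t \<in> T \<Longrightarrow> \<exists>k. t \<in> rel_upper G Y N k"
  shows "\<exists>k. T \<subseteq> rel_upper G Y N k"
  using fin mem
proof (induction T)
  case (insert t T)
  then obtain i j where "T \<subseteq> rel_upper G Y N i" "t \<in> rel_upper G Y N j" by blast
  then have "insert t T \<subseteq> rel_upper G Y N (max i j)"
    using rel_upper_mono[OF Y N, of i "max i j"] rel_upper_mono[OF Y N, of j "max i j"] by auto
  then show ?case by blast
qed simp

lemma rel_upper_eq_one_if_center_trivial:
  assumes "rel_upper G Y {\<one>} (Suc 0) = {\<one>}"
  shows "rel_upper G Y {\<one>} k = {\<one>}"
proof (induction k)
  case (Suc k)
  then show ?case using rel_upper_add[of Y "{\<one>}" "Suc 0" k] assms by simp
qed simp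

text \<open>The directedness hypothesis on \<open>P\<close> covers the exponents of \<open>p\<close>-elements as well as those of
  \<open>p'\<close>-elements.\<close>

lemma invariant_subgroup_torsion_part:
  assumes M: "invariant_subgroup G S M" and S: "subgroup S G" "M \<subseteq> S"
    and abel: "\<And>x y. x \<in> M \<Longrightarrow> y \<in> M \<Longrightarrow> x \<otimes> y = y \<otimes> x"
    and P: "P k" "\<And>m n. P m \<Longrightarrow> P n \<Longrightarrow> \<exists>k. P k \<and> m dvd k \<and> n dvd k"
  shows "invariant_subgroup G S {x \<in> M. \<exists>n::nat. P n \<and> x [^] n = \<one>}" (is "invariant_subgroup G S ?T")
proof -
  note MD = invariant_subgroupD[OF M]
  have Mc: "\<And>x. x \<in> M \<Longrightarrow> x \<in> carrier G" using subgroup_memD[OF MD(1)] .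
  have Sc: "\<And>x. x \<in> S \<Longrightarrow> x \<in> carrier G" using subgroup_memD[OF S(1)] .
  have "subgroup ?T G"
  proof (rule subgroupI)
    show "?T \<subseteq> carrier G" using Mc by blast
    have "\<one> \<in> ?T" using subgroup.one_closed[OF MD(1)] P(1) by auto
    then show "?T \<noteq> {}" by blast
  next
    fix x assume "x \<in> ?T"
    then show "inv x \<in> ?T" using Mc subgroup.m_inv_closed[OF MD(1)] by (auto simp: nat_pow_inv)
  next
    fix x y assume "x \<in> ?T" "y \<in> ?T"
    then obtain m n where xy: "x \<in> M" "y \<in> M" "P m" "P n" "x [^] m = \<one>" "y [^] n = \<one>" by blast
    obtain k where k: "P k" "m dvd k" "n dvd k" using P(2)[OF xy(3,4)] by blast
    have "x [^] k = \<one>" "y [^] k = \<one>" using xy Mc k by (simp_all add: pow_eq_id dvd_trans)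
    then have "(x \<otimes> y) [^] k = \<one>" using pow_mult_distrib[OF abel[OF xy(1,2)]] xy Mc by simp
    then show "x \<otimes> y \<in> ?T" using subgroup.m_closed[OF MD(1)] xy k(1) by blast
  qed
  moreover have "group_conj G x g \<in> ?T" if x: "x \<in> ?T" and g: "g \<in> S" for x g
  proof -
    have "group_conj G x g [^] (n::nat) = group_conj G (x [^] n) g" for n
      using x g Mc Sc by (induction n) (simp_all add: conj_mult)
    then show ?thesis using x g MD(2) Sc by auto
  qed
  ultimately show ?thesis by (simp add: invariant_subgroup_def)
qed

end

text \<open>The quotient by \<open>N\<close> is smaller than \<open>G\<close>, so the induction hypothesis of Baer's theorem applies to it.\<close>

lemma right_engel_hypercentral_mod_normal:
  fixes G :: "'a monoid"
  assumes G: "group G" and fin: "finite (carrier G)" and N: "N \<lhd> G" "N \<noteq> {\<one>\<^bsub>G\<^esub>}" and a: "a \<in> carrier G"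
    and engel: "\<And>g. g \<in> carrier G \<Longrightarrow> \<exists>m. engel_comm G a m g = \<one>\<^bsub>G\<^esub>"
    and IH: "\<And>(H :: 'a monoid) b. group H \<Longrightarrow> card (carrier H) < card (carrier G) \<Longrightarrow> finite (carrier H) \<Longrightarrow>
       b \<in> carrier H \<Longrightarrow> (\<And>g. g \<in> carrier H \<Longrightarrow> \<exists>m. engel_comm H b m g = \<one>\<^bsub>H\<^esub>) \<Longrightarrow>
       \<exists>k. b \<in> rel_upper H (carrier H) {\<one>\<^bsub>H\<^esub>} k"
  shows "\<exists>k. a \<in> rel_upper G (carrier G) N k"
proof -
  interpret G: group G by fact
  obtain H :: "'a monoid" and h where H: "group_epi G H h"
    "\<And>x. x \<in> carrier G \<Longrightarrow> h x = \<one>\<^bsub>H\<^esub> \<longleftrightarrow> x \<in> N"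
    using G.quotient_copy[OF N(1)] by blast
  interpret h: group_epi G H h by fact
  have Nc: "N \<subseteq> carrier G" using N(1) by (simp add: normal_imp_subgroup subgroup.subset)
  have "\<one>\<^bsub>G\<^esub> \<in> N" using N(1) by (simp add: normal_imp_subgroup subgroup.one_closed)
  then obtain n where n: "n \<in> N" "n \<noteq> \<one>\<^bsub>G\<^esub>" using N(2) by blast
  have ninj: "\<not> inj_on h (carrier G)"
  proof
    assume "inj_on h (carrier G)"
    moreover have "h n = h \<one>\<^bsub>G\<^esub>" using H(2)[of n] n Nc by auto
    ultimately show False using n Nc by (meson G.one_closed inj_onD subsetD)
  qed
  have finH: "finite (carrier H)" using fin h.surj by (metis finite_imageI)
  have "card (carrier H) \<noteq> card (carrier G)"
    using ninj fin h.surj eq_card_imp_inj_on by metis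
  moreover have "card (carrier H) \<le> card (carrier G)"
    using card_image_le[OF fin, of h] unfolding h.surj .
  ultimately have small: "card (carrier H) < card (carrier G)" by (rule le_neq_implies_less[rotated])
  have "\<exists>m. engel_comm H (h a) m y = \<one>\<^bsub>H\<^esub>" if y: "y \<in> carrier H" for y
  proof -
    obtain g where g: "g \<in> carrier G" "y = h g" using y unfolding h.surj[symmetric] by blast
    obtain m where "engel_comm G a m g = \<one>\<^bsub>G\<^esub>" using engel[OF g(1)] by blast
    then have "engel_comm H (h a) m y = h \<one>\<^bsub>G\<^esub>" using h.hom_engel[OF a g(1), of m] g(2) by simp
    then show ?thesis by auto
  qed
  then obtain k where "h a \<in> rel_upper H (carrier H) {\<one>\<^bsub>H\<^esub>} k"
    using IH[OF h.H.group_axioms small finH, of "h a"] a by auto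
  then have "a \<in> rel_upper G (carrier G) {y \<in> carrier G. h y \<in> {\<one>\<^bsub>H\<^esub>}} k"
    using h.rel_upper_preimage_iff[OF a] by blast
  moreover have "{y \<in> carrier G. h y \<in> {\<one>\<^bsub>H\<^esub>}} = N" using H(2) Nc by auto
  ultimately show ?thesis by auto
qed

text \<open>The induction step of Baer's theorem. If the center is nontrivial, factor it out. Otherwise the class
  of \<open>a\<close> lies in a proper subgroup, is hypercentral there, and generates a nilpotent normal subgroup \<open>M\<close>
  with center \<open>A \<noteq> 1\<close>. Choose a prime \<open>p\<close> dividing the order of an element of \<open>A\<close>. If also the \<open>p'\<close>-part \<open>Q\<close> of
  \<open>A\<close> were nontrivial, \<open>a\<close> would be hypercentral modulo \<open>Q\<close> and modulo the \<open>p\<close>-part \<open>B\<close>, hence modulo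
  \<open>B \<inter> Q = 1\<close>. So \<open>A\<close> is a \<open>p\<close>-group, and by ascending the upper central series of \<open>M\<close> so is \<open>M\<close>.
  Coprime action shows that all \<open>p'\<close>-elements of \<open>G\<close> centralize the conjugates of \<open>a\<close> and thus \<open>M\<close>, and
  then \<open>nontrivial_central_element\<close> contradicts the triviality of the center.\<close>

lemma finite_right_engel_hypercentral_step:
  fixes G :: "'a monoid" (structure)
  assumes G: "group G" and fin: "finite (carrier G)" and a: "a \<in> carrier G"
    and engel: "\<And>g. g \<in> carrier G \<Longrightarrow> \<exists>m. engel_comm G a m g = \<one>"
    and IH: "\<And>(H :: 'a monoid) b. group H \<Longrightarrow> card (carrier H) < card (carrier G) \<Longrightarrow> finite (carrier H) \<Longrightarrow>
       b \<in> carrier H \<Longrightarrow> (\<And>g. g \<in> carrier H \<Longrightarrow> \<exists>m. engel_comm H b m g = \<one>\<^bsub>H\<^esub>) \<Longrightarrow>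
       \<exists>k. b \<in> rel_upper H (carrier H) {\<one>\<^bsub>H\<^esub>} k"
  shows "\<exists>k. a \<in> rel_upper G (carrier G) {\<one>} k"
proof -
  interpret group G by fact
  let ?C = "carrier G"
  note one_inv = invariant_subgroup_one[of ?C]
  have quot: "\<exists>k. a \<in> rel_upper G ?C N k" if "N \<lhd> G" "N \<noteq> {\<one>}" for N
    by (rule right_engel_hypercentral_mod_normal[OF G fin that a engel IH])
  have engel': "\<exists>m. engel_comm G y m g = \<one>" if y: "y \<in> conj_class a" and g: "g \<in> ?C" for y g
  proof -
    obtain h where h: "h \<in> ?C" "y = group_conj G a h" using y by (auto simp: conj_class_def)
    obtain m where "engel_comm G a m (group_conj G g (inv h)) = \<one>" using engel[of "group_conj G g (inv h)"] h(1) g by auto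
    then have "engel_comm G y m g = \<one>"
      using conj_engel[of a "group_conj G g (inv h)" h m] h(1) g a unfolding h(2) by simp
    then show ?thesis by blast
  qed
  have cc: "conj_class a \<subseteq> ?C" using conj_class_subset[OF a] .
  have nil: "\<exists>k. conj_class a \<inter> H \<subseteq> rel_upper G H {\<one>} k" if H: "subgroup H G" "H \<noteq> ?C" for H
  proof -
    have Hc: "H \<subset> ?C" using H subgroup.subset by blast
    have "\<exists>k. y \<in> rel_upper G H {\<one>} k" if y: "y \<in> conj_class a \<inter> H" for y
    proof -
      let ?H = "G\<lparr>carrier := H\<rparr>"
      have "\<exists>k. y \<in> rel_upper ?H (carrier ?H) {\<one>\<^bsub>?H\<^esub>} k"
      proof (rule IH)
        show "card (carrier ?H) < card ?C" using psubset_card_mono[OF fin Hc] by simp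
        show "group ?H" using subgroup_imp_group[OF H(1)] .
        show "finite (carrier ?H)" using finite_subset[of H ?C] Hc fin by auto
        show "\<exists>m. engel_comm ?H y m g = \<one>\<^bsub>?H\<^esub>" if "g \<in> carrier ?H" for g
          using engel'[of y g] y that Hc engel_consistent[OF H(1), of y g] by auto
      qed (use y in simp)
      then show ?thesis using rel_upper_consistent[OF H(1)] by simp
    qed
    moreover have "finite (conj_class a \<inter> H)" using fin cc finite_subset by blast
    moreover have "invariant_subgroup G H {\<one>}" using invariant_subgroup_one Hc by blast
    moreover have "{\<one>} \<subseteq> H" using subgroup.one_closed[OF H(1)] by simp
    ultimately show ?thesis using finite_subset_rel_upper[OF H(1)] by blast
  qed
  have center_case: ?thesis if z: "z \<in> ?C" "z \<noteq> \<one>" "\<And>g. g \<in> ?C \<Longrightarrow> z \<otimes> g = g \<otimes> z" for z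
  proof -
    let ?Z = "rel_upper G ?C {\<one>} (Suc 0)"
    have "?Z \<lhd> G" using invariant_subgroup_rel_upper[OF subgroup_self one_inv]
      by (simp only: normal_iff_invariant subset_refl)
    moreover have "z \<in> ?Z" using z rel_upper_center[of ?C] by simp
    then have "?Z \<noteq> {\<one>}" using z(2) by blast
    ultimately obtain k where "a \<in> rel_upper G ?C ?Z k" using quot by blast
    then show ?thesis unfolding rel_upper_add by blast
  qed
  show ?thesis
  proof (rule ccontr)
    assume contra: "\<not> ?thesis"
    then have no_center: "z = \<one>" if "z \<in> ?C" "\<And>g. g \<in> ?C \<Longrightarrow> z \<otimes> g = g \<otimes> z" for z
      using center_case that by blast
    have a1: "a \<noteq> \<one>"
    proof
      assume "a = \<one>"
      then have "a \<in> rel_upper G ?C {\<one>} 0" by simp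
      then show False using contra by blast
    qed
    then have "\<exists>g\<in>?C. a \<otimes> g \<noteq> g \<otimes> a" using no_center[OF a] by blast
    then obtain Y where Y: "subgroup Y G" "Y \<noteq> ?C" "conj_class a \<subseteq> Y"
      using engel_conj_class_in_proper_subgroup[OF fin a engel nil] by blast
    obtain k where k: "conj_class a \<subseteq> rel_upper G Y {\<one>} k" using nil[OF Y(1,2)] unfolding inf.absorb1[OF Y(3)] by blast
    define M where "M = generate G (conj_class a)"
    have Minv: "invariant_subgroup G ?C M"
      unfolding M_def using cc conj_class_conj[OF a] by (intro invariant_subgroup_generate) auto
    note MD = invariant_subgroupD[OF Minv]
    have Mc: "M \<subseteq> ?C" using MD(1) by (rule subgroup.subset)
    have cM: "conj_class a \<subseteq> M" unfolding M_def by (intro subsetI generate.incl)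
    have M_least: "M \<subseteq> V" if "subgroup V G" "conj_class a \<subseteq> V" for V
      unfolding M_def using generate_subgroup_incl[OF that(2,1)] .
    have "invariant_subgroup G Y {\<one>}" using invariant_subgroup_one[OF subgroup.subset[OF Y(1)]] .
    then have "subgroup (rel_upper G Y {\<one>} k) G"
      by (rule invariant_subgroupD(1)[OF invariant_subgroup_rel_upper[OF Y(1)]])
    then have "M \<subseteq> rel_upper G Y {\<one>} k" using M_least k by blast
    then have Mk: "M \<subseteq> rel_upper G M {\<one>} k"
      using rel_upper_Int_subgroup[OF MD(1) M_least[OF Y(1,3)], of k] by blast
    define A where "A = {z \<in> M. \<forall>g\<in>M. z \<otimes> g = g \<otimes> z}"
    have A_eq: "A = rel_upper G M {\<one>} (Suc 0)" using rel_upper_center[OF Mc] by (simp add: A_def)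
    have oneM: "{\<one>} \<subseteq> M" using subgroup.one_closed[OF MD(1)] by simp
    have inv1: "invariant_subgroup G M {\<one>}" using invariant_subgroup_one[OF Mc] .
    have A1: "A \<noteq> {\<one>}"
    proof
      assume "A = {\<one>}"
      then have "M \<subseteq> {\<one>}" using rel_upper_eq_one_if_center_trivial[of M k] A_eq Mk by simp
      then show False using cM conj_class_self[OF a] a1 by blast
    qed
    have Asub: "subgroup A G" unfolding A_eq using invariant_subgroupD(1)[OF invariant_subgroup_rel_upper[OF MD(1) inv1]] .
    have Ainv: "invariant_subgroup G ?C A"
    proof -
      have "group_conj G z g \<otimes> x = x \<otimes> group_conj G z g" if z: "z \<in> A" and g: "g \<in> ?C" and x: "x \<in> M" for z g x
      proof -
        have zc: "z \<in> ?C" and xc: "x \<in> ?C" using z x Mc by (auto simp: A_def)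
        define u where "u = group_conj G x (inv g)"
        have "u \<in> M" using MD(2)[of "inv g" x] g x by (simp add: u_def)
        then have "group_conj G (z \<otimes> u) g = group_conj G (u \<otimes> z) g" using z by (simp add: A_def)
        then show ?thesis using zc xc g by (simp add: conj_mult u_def)
      qed
      then show ?thesis using Asub MD(2) by (auto simp: invariant_subgroup_def A_def)
    qed
    have Aab: "x \<otimes> y = y \<otimes> x" if "x \<in> A" "y \<in> A" for x y using that unfolding A_def by blast
    have AM: "A \<subseteq> M" unfolding A_def by blast
    then have AC: "A \<subseteq> ?C" using Mc by blast
    obtain z where z: "z \<in> A" "z \<noteq> \<one>" using A1 subgroup.one_closed[OF Asub] by blast
    have zc: "z \<in> ?C" using z AC by blast
    have "ord z \<noteq> 1" using ord_eq_1[OF zc] z(2) by simp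
    then obtain p where p: "Factorial_Ring.prime p" "p dvd ord z" using prime_factor_nat by blast
    obtain n where n: "ord z = p * n" using p(2) by (elim dvdE)
    \<comment> \<open>an element of order \<open>p\<close>\<close>
    define w where "w = z [^] n"
    have wc: "w \<in> ?C" using zc by (simp add: w_def)
    have wA: "w \<in> A" unfolding w_def by (rule subgroup_pow[OF Asub z(1)])
    have wp: "w [^] p = \<one>" using zc n by (simp add: w_def nat_pow_pow mult.commute[of n] flip: n)
    have w1: "w \<noteq> \<one>"
    proof
      assume "w = \<one>"
      then have "ord z dvd n" using pow_eq_id[OF zc] by (simp add: w_def)
      moreover have "ord z > 0" using ord_ge_1[OF fin zc] by simp
      ultimately show False using n prime_ge_2_nat[OF p(1)] by (auto dest!: dvd_imp_le)
    qed
    define B where "B = {x \<in> A. \<exists>n::nat. (\<exists>s. n = p ^ s) \<and> x [^] n = \<one>}"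
    define Q where "Q = {x \<in> A. \<exists>n::nat. coprime n p \<and> x [^] n = \<one>}"
    have "invariant_subgroup G ?C B" unfolding B_def
    proof (rule invariant_subgroup_torsion_part[OF Ainv subgroup_self AC Aab])
      show "\<exists>s. p ^ 0 = p ^ s" by blast
      fix m n assume "\<exists>s. m = p ^ s" "\<exists>s. n = p ^ s"
      then have "\<exists>s. m * n = p ^ s" by (auto simp flip: power_add)
      then show "\<exists>k. (\<exists>s. k = p ^ s) \<and> m dvd k \<and> n dvd k" by (meson dvd_triv_left dvd_triv_right)
    qed
    then have Bn: "B \<lhd> G" by (simp add: normal_iff_invariant)
    have "invariant_subgroup G ?C Q" unfolding Q_def
    proof (rule invariant_subgroup_torsion_part[OF Ainv subgroup_self AC Aab])
      show "coprime 1 p" by simp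
      fix m n assume "coprime m p" "coprime n p"
      then have "coprime (m * n) p" by simp
      then show "\<exists>k. coprime k p \<and> m dvd k \<and> n dvd k" by (meson dvd_triv_left dvd_triv_right)
    qed
    then have Qn: "Q \<lhd> G" by (simp add: normal_iff_invariant)
    have "\<exists>s. p = p ^ s" by (rule exI[of _ 1]) simp
    then have "w \<in> B" unfolding B_def using wA wp by blast
    then have B1: "B \<noteq> {\<one>}" using w1 by blast
    have BQ: "B \<inter> Q = {\<one>}"
    proof -
      have "x = \<one>" if x: "x \<in> B \<inter> Q" for x
      proof -
        obtain s m where "x \<in> ?C" "x [^] (p ^ s) = \<one>" "x [^] m = \<one>" "coprime m p"
          using x AC by (auto simp: B_def Q_def)
        then show ?thesis using pow_coprime_eq_one[of x "p ^ s" m] by (simp add: coprime_commute)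
      qed
      moreover have "\<one> \<in> B" "\<one> \<in> Q"
        using Bn Qn by (simp_all add: normal_imp_subgroup subgroup.one_closed)
      ultimately show ?thesis by blast
    qed
    have Q1: "Q = {\<one>}"
    proof (rule ccontr)
      assume "Q \<noteq> {\<one>}"
      then obtain i j where ij: "a \<in> rel_upper G ?C B i" "a \<in> rel_upper G ?C Q j"
        using quot Bn B1 Qn by blast
      have "rel_upper G ?C B i \<subseteq> rel_upper G ?C B (max i j)" "rel_upper G ?C Q j \<subseteq> rel_upper G ?C Q (max i j)"
        using normal_rel_upper_mono[OF Bn] normal_rel_upper_mono[OF Qn] by simp_all
      then have "a \<in> rel_upper G ?C (B \<inter> Q) (max i j)" using ij unfolding rel_upper_Int by blast
      then show False using contra unfolding BQ by blast
    qed
    \<comment> \<open>\<open>M\<close> has no nontrivial elements of order prime to \<open>p\<close>: such an element of the next center of \<open>M\<close>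
      acts coprimely on \<open>M\<close> with commutators in the present center, hence is central\<close>
    have free: "x = \<one>" if "x \<in> rel_upper G M {\<one>} i" "coprime r p" "x [^] (r::nat) = \<one>" for i x r
      using that
    proof (induction i arbitrary: x)
      case (Suc i)
      let ?U = "rel_upper G M {\<one>} i"
      note Uinv = invariant_subgroup_rel_upper[OF MD(1) inv1, of i]
      have xM: "x \<in> M" using Suc.prems by simp
      have xc: "x \<in> ?C" using xM Mc by blast
      have "group_comm G y x = \<one>" if y: "y \<in> M" for y
      proof (rule engel_coprime_commute)
        show yc: "y \<in> ?C" using y Mc by blast
        show "engel_comm G y k x = \<one>" using engel_in_rel_upper[of y M "{\<one>}" k x] Mk y xM by blast
        show "engel_comm G y (Suc m) x \<in> ?U" for m
        proof (induction m)
          case 0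
          have "group_comm G x y \<in> ?U" using Suc.prems y by simp
          then show ?case using comm_swap[OF xc yc] subgroup.m_inv_closed[OF invariant_subgroupD(1)[OF Uinv]] by simp
        next
          case (Suc m)
          then show ?case using invariant_subgroup_comm[OF Uinv Mc _ xM] by simp
        qed
        show "t = \<one>" if "t \<in> ?U" "t [^] r = \<one>" for t using Suc.IH[OF that(1) Suc.prems(2) that(2)] .
      qed (use xc Suc.prems in auto)
      then have "x \<in> A" using xM xc Mc comm_eq_one_iff[of _ x] by (auto simp: A_def subset_iff)
      then have "x \<in> Q" using Suc.prems by (auto simp: Q_def)
      then show ?case using Q1 by simp
    qed simp
    have central: "x \<otimes> g = g \<otimes> x" if x: "x \<in> M" and g: "g \<in> ?C" "coprime r p" "g [^] (r::nat) = \<one>" for x g r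
    proof -
      have "conj_class a \<subseteq> {y \<in> ?C. g \<otimes> y = y \<otimes> g}"
      proof
        fix y assume y: "y \<in> conj_class a"
        have yc: "y \<in> ?C" and yM: "y \<in> M" using y cc cM by auto
        obtain m where m: "engel_comm G y m g = \<one>" using engel'[OF y g(1)] by blast
        have yMm: "engel_comm G y m g \<in> M" for m
          by (induction m) (use yM invariant_subgroup_comm[OF Minv _ _ g(1)] in auto)
        have "group_comm G y g = \<one>"
          by (rule engel_coprime_commute[OF yc g(1,3) m yMm]) (use free Mk g(2) in blast)
        then show "y \<in> {y \<in> ?C. g \<otimes> y = y \<otimes> g}" using comm_eq_one_iff[OF yc g(1)] yc by simp
      qed
      then have "M \<subseteq> {y \<in> ?C. g \<otimes> y = y \<otimes> g}" by (rule M_least[OF subgroup_commuting[OF g(1)]])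
      then show ?thesis using x by auto
    qed
    have pM: "p dvd card M"
    proof -
      interpret M: group "G\<lparr>carrier := M\<rparr>" using subgroup_imp_group[OF MD(1)] .
      have wM: "w \<in> M" using wA AM by blast
      have "w [^]\<^bsub>G\<lparr>carrier := M\<rparr>\<^esub> order (G\<lparr>carrier := M\<rparr>) = \<one>\<^bsub>G\<lparr>carrier := M\<rparr>\<^esub>"
        using M.pow_order_eq_1[of w] wM by simp
      then have "w [^] card M = \<one>" by (simp add: order_def flip: nat_pow_consistent)
      then have "\<not> coprime p (card M)" using pow_coprime_eq_one[OF wc wp] w1 by blast
      then show ?thesis using p(1) prime_imp_coprime by blast
    qed
    show False
    proof (rule nontrivial_central_element[OF fin p(1) Minv pM])
      show "x \<otimes> g = g \<otimes> x" if "x \<in> M" "g \<in> ?C" "coprime r p" "g [^] (r::nat) = \<one>" for x g r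
        by (rule central[OF that])
    next
      fix z assume z: "z \<in> M" "z \<noteq> \<one>" "\<And>g. g \<in> ?C \<Longrightarrow> z \<otimes> g = g \<otimes> z"
      have "z \<in> ?C" using z(1) Mc by blast
      then show False using no_center[of z] z(2,3) by simp
    qed
  qed
qed

lemma finite_right_engel_hypercentral:
  fixes G :: "'a monoid"
  assumes "group G" "finite (carrier G)" "a \<in> carrier G"
    and "\<And>g. g \<in> carrier G \<Longrightarrow> \<exists>m. engel_comm G a m g = \<one>\<^bsub>G\<^esub>"
  shows "\<exists>k. a \<in> rel_upper G (carrier G) {\<one>\<^bsub>G\<^esub>} k"
  using assms
proof (induction "card (carrier G)" arbitrary: G a rule: less_induct)
  case less
  show ?case
    by (rule finite_right_engel_hypercentral_step[OF less.prems(1-3)]) (use less in blast)+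
qed

section \<open>Abelian sections of bounded exponent\<close>

text \<open>The length \<open>j\<close> may depend on \<open>K\<close>; making it uniform is the task of this section.\<close>

definition residually_hypercentral :: "('a, 'b) monoid_scheme \<Rightarrow> 'a set \<Rightarrow> bool" where
  "residually_hypercentral G A \<longleftrightarrow>
     (\<forall>K. finite_index_subgroup K G \<longrightarrow> (\<exists>j. rel_lower G (carrier G) A j \<subseteq> K))"

lemma rel_lower_add: "rel_lower G S (rel_lower G S A i) j = rel_lower G S A (i + j)"
  by (induction j) auto

context group
begin

lemma rel_lower_base_mono: "A \<subseteq> B \<Longrightarrow> rel_lower G S A j \<subseteq> rel_lower G S B j"
proof (induction j)
  case (Suc j)
  then have "{group_comm G x g |x g. x \<in> rel_lower G S A j \<and> g \<in> S} \<subseteq>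
      {group_comm G x g |x g. x \<in> rel_lower G S B j \<and> g \<in> S}" by blast
  then show ?case by (simp add: mono_generate)
qed simp

lemma rel_lower_acting_mono: "S \<subseteq> S' \<Longrightarrow> rel_lower G S A j \<subseteq> rel_lower G S' A j"
proof (induction j)
  case (Suc j)
  then have "{group_comm G x g |x g. x \<in> rel_lower G S A j \<and> g \<in> S} \<subseteq>
      {group_comm G x g |x g. x \<in> rel_lower G S' A j \<and> g \<in> S'}" by blast
  then show ?case by (simp add: mono_generate)
qed simp

lemma residually_hypercentral_subset:
  assumes "residually_hypercentral G B" "A \<subseteq> B"
  shows "residually_hypercentral G A"
  using assms rel_lower_base_mono[OF assms(2)] unfolding residually_hypercentral_def by (meson subset_trans)

lemma pow_coprime_in_subgroup:
  assumes V: "subgroup V G" and x: "x \<in> carrier G" and p: "Factorial_Ring.prime p" "x [^] (p::nat) = \<one>"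
    and l: "x [^] (l::nat) \<in> V" "\<not> p dvd l"
  shows "x \<in> V"
proof -
  have "coprime l p" using prime_imp_coprime[OF p(1) l(2)] by (simp add: coprime_commute)
  moreover have "l \<noteq> 0" using l(2) dvd_0_right by metis
  ultimately obtain u v where uv: "l * u = p * v + 1" using bezout_nat[of l p] by auto
  have "x [^] (l * u) \<in> V" using subgroup_pow[OF V l(1), of u] x by (simp add: nat_pow_pow)
  moreover have "x [^] (l * u) = (x [^] p) [^] v \<otimes> x"
    unfolding uv using x by (simp add: nat_pow_pow)
  ultimately show ?thesis using x p(2) by simp
qed

lemma subgroup_of_finite_exponent:
  assumes "V \<subseteq> carrier G" "\<one> \<in> V" "\<And>x y. x \<in> V \<Longrightarrow> y \<in> V \<Longrightarrow> x \<otimes> y \<in> V"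
    and m: "m > 0" "\<And>x. x \<in> V \<Longrightarrow> x [^] (m::nat) = \<one>"
  shows "subgroup V G"
proof (rule subgroupI)
  fix x assume x: "x \<in> V"
  have xc: "x \<in> carrier G" using x assms(1) by blast
  have pow: "x [^] n \<in> V" for n :: nat using assms(2,3) x by (induction n) auto
  have "x [^] (m - 1) \<otimes> x = \<one>" using m(2)[OF x] m(1) by (simp flip: nat_pow_Suc)
  then have "inv x = x [^] (m - 1)" using xc by (simp add: inv_equality)
  then show "inv x \<in> V" using pow by simp
qed (use assms in auto)

text \<open>If the series never reaches the identity, then its terms \<open>L\<^sub>j\<close> decrease strictly: a term that is repeated is
  repeated forever, and none of its nontrivial elements could be separated from the identity by a subgroup
  of finite index. Choose \<open>e\<^sub>j\<close> in \<open>L\<^sub>j\<close> but not in \<open>L\<^sub>j\<^sub>+\<^sub>1\<close>. The subgroup \<open>S\<close> generated by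
  \<open>d\<^sub>j = e\<^sub>0 e\<^sub>j\<inverse>\<close> for all \<open>j\<close> omits \<open>e\<^sub>0\<close>, so a subgroup \<open>K\<close> of finite index contains \<open>S\<close> and omits \<open>e\<^sub>0\<close>. It
  contains some \<open>L\<^sub>j\<close>, hence \<open>e\<^sub>j\<close> and \<open>d\<^sub>j e\<^sub>j = e\<^sub>0\<close>, a contradiction.\<close>

lemma elementary_abelian_lower_terminates:
  assumes sep: "finite_index_separable G" and p: "Factorial_Ring.prime p"
    and A: "invariant_subgroup G (carrier G) A"
    and abel: "\<And>x y. x \<in> A \<Longrightarrow> y \<in> A \<Longrightarrow> x \<otimes> y = y \<otimes> x"
    and expo: "\<And>x. x \<in> A \<Longrightarrow> x [^] (p::nat) = \<one>"
    and res: "residually_hypercentral G A"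
  shows "\<exists>j. rel_lower G (carrier G) A j \<subseteq> {\<one>}"
proof (rule ccontr)
  assume contra: "\<not> ?thesis"
  let ?L = "rel_lower G (carrier G) A"
  note selfinv = invariant_subgroup_self[OF subgroup_self]
  have Linv: "invariant_subgroup G (carrier G) (?L j)" for j
    by (rule invariant_subgroup_rel_lower[OF subset_refl A selfinv])
  have Lsub: "subgroup (?L j) G" for j using invariant_subgroupD(1)[OF Linv] .
  have Lmono: "i \<le> j \<Longrightarrow> ?L j \<subseteq> ?L i" for i j by (rule rel_lower_mono[OF subset_refl A selfinv])
  have Asub: "subgroup A G" using invariant_subgroupD(1)[OF A] .
  have Ac: "\<And>x. x \<in> A \<Longrightarrow> x \<in> carrier G" using subgroup_memD[OF Asub] .
  have LA: "?L j \<subseteq> A" for j using Lmono[of 0 j] by simp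
  have strict: "\<exists>x. x \<in> ?L j \<and> x \<notin> ?L (Suc j)" for j
  proof (rule ccontr)
    assume "\<not> ?thesis"
    then have eq: "?L (j + 1) = ?L j" using Lmono[of j "Suc j"] by (simp del: rel_lower.simps) blast
    have const: "?L (j + i) = ?L j" for i
    proof (induction i)
      case (Suc i)
      have "?L (j + Suc i) = rel_lower G (carrier G) (?L (j + i)) 1"
        using rel_lower_add[of G "carrier G" A "j + i" 1] by simp
      also have "\<dots> = ?L (j + 1)" unfolding Suc.IH rel_lower_add ..
      finally show ?case using eq by simp
    qed simp
    obtain x where x: "x \<in> ?L j" "x \<noteq> \<one>" using contra by blast
    obtain K where K: "finite_index_subgroup K G" "x \<notin> K"
      using finite_index_separableD[OF sep triv_subgroup, of x] x Ac LA by (metis singletonD subsetD)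
    obtain i where i: "?L i \<subseteq> K" using res K(1) unfolding residually_hypercentral_def by blast
    have "?L (j + i) \<subseteq> K" using Lmono[of i "j + i"] i by auto
    then show False using const x(1) K(2) by auto
  qed
  then obtain e where e: "\<And>j. e j \<in> ?L j" "\<And>j. e j \<notin> ?L (Suc j)" by metis
  have eA: "e j \<in> A" for j using e(1) LA by blast
  have ec: "e j \<in> carrier G" for j using eA Ac by blast
  define d where "d j = e 0 \<otimes> inv (e j)" for j
  have dA: "d j \<in> A" for j
    using eA by (simp add: d_def subgroup.m_closed[OF Asub] subgroup.m_inv_closed[OF Asub])
  note powA = subgroup_pow[OF Asub]
  \<comment> \<open>\<open>W j\<close> is the subgroup generated by \<open>d 1, \<dots>, d j\<close>, as a set of products of nonnegative powers\<close>
  define W where "W = rec_nat {\<one>} (\<lambda>j V. {w \<otimes> d (Suc j) [^] l |w l. w \<in> V \<and> l \<in> (UNIV :: nat set)})"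
  have W0: "W 0 = {\<one>}" by (simp add: W_def)
  have WS: "W (Suc j) = {w \<otimes> d (Suc j) [^] l |w l. w \<in> W j \<and> l \<in> (UNIV :: nat set)}" for j
    by (simp add: W_def)
  have WA: "W j \<subseteq> A" for j
  proof (induction j)
    case 0
    then show ?case using subgroup.one_closed[OF Asub] by (simp add: W0)
  next
    case (Suc j)
    then show ?case using powA[OF dA] by (auto simp: WS subgroup.m_closed[OF Asub])
  qed
  have W_Suc: "W j \<subseteq> W (Suc j)" for j
  proof
    fix w assume w: "w \<in> W j"
    then have "w = w \<otimes> d (Suc j) [^] (0::nat)" using WA Ac by (simp add: subset_iff)
    then show "w \<in> W (Suc j)" unfolding WS using w by blast
  qed
  have W_mono: "i \<le> j \<Longrightarrow> W i \<subseteq> W j" for i j by (rule lift_Suc_mono_le[of W, OF W_Suc])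
  have W_one: "\<one> \<in> W j" for j using W_mono[of 0 j] W0 by simp
  have W_mult: "x \<otimes> y \<in> W j" if "x \<in> W j" "y \<in> W j" for x y j
    using that
  proof (induction j arbitrary: x y)
    case (Suc j)
    obtain u and l :: nat where x: "x = u \<otimes> d (Suc j) [^] l" "u \<in> W j"
      using Suc.prems(1) unfolding WS by blast
    obtain v and n :: nat where y: "y = v \<otimes> d (Suc j) [^] n" "v \<in> W j"
      using Suc.prems(2) unfolding WS by blast
    have A4: "u \<in> A" "v \<in> A" "d (Suc j) [^] l \<in> A" "d (Suc j) [^] n \<in> A" using WA x y powA[OF dA] by auto
    have "x \<otimes> y = u \<otimes> (d (Suc j) [^] l \<otimes> v) \<otimes> d (Suc j) [^] n"
      using A4[THEN Ac] by (simp add: x y m_assoc)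
    also have "\<dots> = u \<otimes> v \<otimes> (d (Suc j) [^] l \<otimes> d (Suc j) [^] n)"
      unfolding abel[OF A4(3,2)] using A4[THEN Ac] by (simp add: m_assoc)
    also have "\<dots> = u \<otimes> v \<otimes> d (Suc j) [^] (l + n)" using Ac[OF dA] by (simp add: nat_pow_mult)
    finally show ?case unfolding WS using Suc.IH[OF x(2) y(2)] by blast
  qed (simp add: W0)
  define S where "S = (\<Union>j. W j)"
  have SA: "S \<subseteq> A" using WA by (auto simp: S_def)
  have Ssub: "subgroup S G"
  proof (rule subgroup_of_finite_exponent[of _ p])
    show "S \<subseteq> carrier G" using SA Ac by blast
    show "\<one> \<in> S" using W_one by (auto simp: S_def)
    show "p > 0" using p by (simp add: prime_gt_0_nat)
    show "x [^] p = \<one>" if "x \<in> S" for x using expo SA that by blast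
    fix x y assume "x \<in> S" "y \<in> S"
    then obtain i j where "x \<in> W i" "y \<in> W j" by (auto simp: S_def)
    then have "x \<in> W (max i j)" "y \<in> W (max i j)" using W_mono[of _ "max i j"] by (meson max.cobounded1 max.cobounded2 subsetD)+
    then show "x \<otimes> y \<in> S" using W_mult by (auto simp: S_def)
  qed
  \<comment> \<open>the independence of the \<open>e j\<close>, in a form that survives adjoining the next \<open>d j\<close>\<close>
  have indep: "p dvd i \<and> w = \<one>" if "w \<in> W j" "w \<otimes> e 0 [^] (i::nat) \<in> ?L (Suc j)" for w i j
    using that
  proof (induction j arbitrary: w i)
    case 0
    then have "e 0 [^] i \<in> ?L (Suc 0)" "w = \<one>" using ec by (simp_all add: W0 del: rel_lower.simps)
    then show ?case using pow_coprime_in_subgroup[OF Lsub ec p expo[OF eA]] e(2) by blast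
  next
    case (Suc j)
    obtain u l where w: "w = u \<otimes> d (Suc j) [^] (l::nat)" "u \<in> W j" using Suc.prems(1) unfolding WS by blast
    define f where "f = e (Suc j)"
    have fA: "f \<in> A" using eA by (simp add: f_def)
    have invfA: "inv f \<in> A" using fA by (simp add: subgroup.m_inv_closed[OF Asub])
    have uA: "u \<in> A" using w WA by blast
    have dl: "d (Suc j) [^] l = e 0 [^] l \<otimes> inv f [^] l"
      unfolding d_def f_def[symmetric] by (rule pow_mult_distrib[OF abel[OF eA invfA]]) (use Ac eA invfA in auto)
    have elA: "e 0 [^] l \<in> A" "e 0 [^] i \<in> A" "inv f [^] l \<in> A" "f [^] l \<in> A"
      using powA eA invfA fA by auto
    have inv_pow: "inv f [^] l \<otimes> f [^] l = \<one>" using Ac[OF fA] by (simp add: nat_pow_inv)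
    \<comment> \<open>moving the power of \<open>f\<close> to the other side leaves a product that \<open>Suc.IH\<close> applies to\<close>
    have "w \<otimes> e 0 [^] i \<otimes> f [^] l = u \<otimes> e 0 [^] l \<otimes> (inv f [^] l \<otimes> e 0 [^] i) \<otimes> f [^] l"
      unfolding w(1) dl using Ac elA uA by (simp add: m_assoc)
    also have "\<dots> = u \<otimes> (e 0 [^] l \<otimes> e 0 [^] i) \<otimes> (inv f [^] l \<otimes> f [^] l)"
      unfolding abel[OF elA(3,2)] using Ac elA uA by (simp add: m_assoc)
    also have "\<dots> = u \<otimes> e 0 [^] (l + i)" unfolding inv_pow using Ac uA ec by (simp add: nat_pow_mult)
    finally have eq: "u \<otimes> e 0 [^] (l + i) = w \<otimes> e 0 [^] i \<otimes> f [^] l" by simp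
    have pow_L: "f [^] n \<in> ?L (Suc j)" for n :: nat
      using subgroup_pow[OF Lsub e(1)] unfolding f_def .
    have "w \<otimes> e 0 [^] i \<in> ?L (Suc j)" using Suc.prems(2) Lmono[of "Suc j" "Suc (Suc j)"] by auto
    then have "u \<otimes> e 0 [^] (l + i) \<in> ?L (Suc j)" unfolding eq using pow_L by (rule subgroup.m_closed[OF Lsub])
    then have u: "p dvd l + i" "u = \<one>" using Suc.IH[OF w(2)] by blast+
    have e1: "e 0 [^] (p * n) = \<one>" for n using expo[OF eA] ec by (simp flip: nat_pow_pow)
    then have "e 0 [^] (l + i) = \<one>" using u(1) by (metis dvd_def)
    then have "f [^] l = inv (w \<otimes> e 0 [^] i)"
      using eq u(2) Ac[OF fA] Ac[OF uA] Ac[OF WA[THEN subsetD, OF Suc.prems(1)]] ec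
      by (metis inv_equality inv_comm l_one m_closed nat_pow_closed)
    then have "f [^] l \<in> ?L (Suc (Suc j))" using subgroup.m_inv_closed[OF Lsub Suc.prems(2)] by (simp del: rel_lower.simps)
    then have l: "p dvd l" using pow_coprime_in_subgroup[OF Lsub Ac[OF fA] p expo[OF fA]] e(2)[of "Suc j"] unfolding f_def by blast
    then have i: "p dvd i" using u(1) dvd_add_right_iff by blast
    have "d (Suc j) [^] l = \<one>" using l expo[OF dA] Ac[OF dA] by (auto simp: dvd_def simp flip: nat_pow_pow)
    then have "w = \<one>" using w(1) u(2) by simp
    then show ?case using i by simp
  qed
  have "e 0 \<notin> S"
  proof
    assume "e 0 \<in> S"
    then obtain j where j: "e 0 \<in> W j" by (auto simp: S_def)
    \<comment> \<open>independence with \<open>w = e 0\<close> and exponent \<open>p - 1\<close>, where the product is trivial\<close>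
    have "e 0 \<otimes> e 0 [^] (p - 1) = e 0 [^] Suc (p - 1)" using ec by (simp only: nat_pow_Suc2)
    also have "\<dots> = \<one>" using expo[OF eA] prime_gt_0_nat[OF p] by simp
    finally have "e 0 \<otimes> e 0 [^] (p - 1) \<in> ?L (Suc j)" using subgroup.one_closed[OF Lsub] by (simp del: rel_lower.simps)
    then have "p dvd p - 1" using indep[OF j] by blast
    then show False using prime_ge_2_nat[OF p] by (auto dest!: dvd_imp_le)
  qed
  then obtain K where K: "finite_index_subgroup K G" "S \<subseteq> K" "e 0 \<notin> K"
    using finite_index_separableD[OF sep Ssub ec] by blast
  have Ksub: "subgroup K G" using K(1) by (simp add: finite_index_subgroup_def)
  obtain j where j: "?L j \<subseteq> K" using res K(1) unfolding residually_hypercentral_def by blast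
  then have ejK: "e j \<in> K" using e(1) by blast
  have "d j \<in> K"
  proof (cases j)
    case 0
    then show ?thesis using ec subgroup.one_closed[OF Ksub] by (simp add: d_def)
  next
    case (Suc i)
    have "d (Suc i) = \<one> \<otimes> d (Suc i) [^] (1::nat)" using Ac[OF dA] by simp
    then have "d (Suc i) \<in> W (Suc i)" unfolding WS using W_one by blast
    then show ?thesis using K(2) Suc by (auto simp: S_def)
  qed
  then have "d j \<otimes> e j \<in> K" using ejK by (rule subgroup.m_closed[OF Ksub])
  then show False using K(3) ec by (simp add: d_def m_assoc)
qed

end

text \<open>Subgroups of finite index of \<open>H\<close> pull back to subgroups of finite index of \<open>G\<close>, and the descending series
  maps onto the descending series.\<close>

lemma (in group_epi) residually_hypercentral_image:
  assumes A: "subgroup A G" and res: "residually_hypercentral G A"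
  shows "residually_hypercentral H (h ` A)"
  unfolding residually_hypercentral_def
proof (intro allI impI)
  fix K assume "finite_index_subgroup K H"
  then obtain j where j: "rel_lower G (carrier G) A j \<subseteq> {x \<in> carrier G. h x \<in> K}"
    using res finite_index_preimage unfolding residually_hypercentral_def by blast
  have im: "rel_lower H (carrier H) (h ` A) j = h ` rel_lower G (carrier G) A j"
    using rel_lower_image[OF G.subgroup_self A subgroup.subset[OF A]] unfolding surj by blast
  show "\<exists>j. rel_lower H (carrier H) (h ` A) j \<subseteq> K"
    by (rule exI[of _ j]) (unfold im, use j in blast)
qed

lemma (in group_epi) invariant_subgroup_image:
  assumes "invariant_subgroup G (carrier G) A"
  shows "invariant_subgroup H (carrier H) (h ` A)"
  unfolding invariant_subgroup_def
proof (intro conjI ballI)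
  note AD = G.invariant_subgroupD[OF assms]
  show "subgroup (h ` A) H" by (rule subgroup_img_is_subgroup[OF AD(1)])
  fix g v assume g: "g \<in> carrier H" and v: "v \<in> h ` A"
  obtain x where x: "x \<in> carrier G" "h x = g" using g unfolding surj[symmetric] by blast
  obtain u where u: "u \<in> A" "h u = v" using v by blast
  have "group_conj H v g = h (group_conj G u x)" using x u G.subgroup_memD[OF AD(1) u(1)] by auto
  then show "group_conj H v g \<in> h ` A" using AD(2)[OF x(1) u(1)] by blast
qed

lemma (in group_epi) rel_lower_subset_kernel:
  assumes A: "subgroup A G" and N: "\<And>x. x \<in> carrier G \<Longrightarrow> h x = \<one>\<^bsub>H\<^esub> \<Longrightarrow> x \<in> N"
    and L: "rel_lower H (carrier H) (h ` A) j \<subseteq> {\<one>\<^bsub>H\<^esub>}"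
  shows "rel_lower G (carrier G) A j \<subseteq> N"
proof -
  have im: "rel_lower H (carrier H) (h ` A) j = h ` rel_lower G (carrier G) A j"
    "rel_lower G (carrier G) A j \<subseteq> carrier G"
    using rel_lower_image[OF G.subgroup_self A subgroup.subset[OF A]] unfolding surj by blast+
  show ?thesis using L N im(2) unfolding im(1) by blast
qed

lemma (in group_epi) image_commute:
  assumes "x \<in> carrier G" "y \<in> carrier G" "h (group_comm G x y) = \<one>\<^bsub>H\<^esub>"
  shows "h x \<otimes>\<^bsub>H\<^esub> h y = h y \<otimes>\<^bsub>H\<^esub> h x"
  using assms H.comm_eq_one_iff[of "h x" "h y"] by simp

context group
begin

lemma invariant_subgroup_power_in:
  assumes A: "invariant_subgroup G (carrier G) A" and N: "invariant_subgroup G (carrier G) N"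
    and abel: "\<And>x y. x \<in> A \<Longrightarrow> y \<in> A \<Longrightarrow> group_comm G x y \<in> N"
  shows "invariant_subgroup G (carrier G) {x \<in> A. x [^] (m::nat) \<in> N}"
proof -
  have "N \<lhd> G" using N by (simp add: normal_iff_invariant)
  then obtain H :: "'a monoid" and h where H: "group_epi G H h"
    "\<And>x. x \<in> carrier G \<Longrightarrow> h x = \<one>\<^bsub>H\<^esub> \<longleftrightarrow> x \<in> N"
    using quotient_copy by blast
  interpret h: group_epi G H h by fact
  have As: "subgroup A G" using invariant_subgroupD(1)[OF A] .
  have Ac: "\<And>x. x \<in> A \<Longrightarrow> x \<in> carrier G" using subgroup_memD[OF As] .
  let ?B = "{x \<in> A. x [^] m \<in> N}"
  have eq: "?B = {x \<in> A. h x [^]\<^bsub>H\<^esub> m = \<one>\<^bsub>H\<^esub>}" 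
    using H(2) Ac by (auto simp flip: h.hom_nat_pow)
  have "subgroup ?B G" unfolding eq
  proof (rule subgroupI)
    have "\<one> \<in> {x \<in> A. h x [^]\<^bsub>H\<^esub> m = \<one>\<^bsub>H\<^esub>}" using subgroup.one_closed[OF As] by simp
    then show "{x \<in> A. h x [^]\<^bsub>H\<^esub> m = \<one>\<^bsub>H\<^esub>} \<noteq> {}" by blast
  next
    fix x y assume "x \<in> {x \<in> A. h x [^]\<^bsub>H\<^esub> m = \<one>\<^bsub>H\<^esub>}" "y \<in> {x \<in> A. h x [^]\<^bsub>H\<^esub> m = \<one>\<^bsub>H\<^esub>}"
    then have xy: "x \<in> A" "y \<in> A" "h x [^]\<^bsub>H\<^esub> m = \<one>\<^bsub>H\<^esub>" "h y [^]\<^bsub>H\<^esub> m = \<one>\<^bsub>H\<^esub>" by auto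
    have "h (group_comm G x y) = \<one>\<^bsub>H\<^esub>" using H(2)[of "group_comm G x y"] abel[OF xy(1,2)] Ac[OF xy(1)] Ac[OF xy(2)] comm_closed by blast
    then have "h x \<otimes>\<^bsub>H\<^esub> h y = h y \<otimes>\<^bsub>H\<^esub> h x" by (intro h.image_commute Ac xy)
    then show "x \<otimes> y \<in> {x \<in> A. h x [^]\<^bsub>H\<^esub> m = \<one>\<^bsub>H\<^esub>}"
      using xy Ac h.H.pow_mult_distrib[of "h x" "h y" m] subgroup.m_closed[OF As] by simp
  qed (use Ac subgroup.m_inv_closed[OF As] in \<open>auto simp: h.H.nat_pow_inv\<close>)
  moreover have "group_conj G x g \<in> ?B" if x: "x \<in> ?B" and g: "g \<in> carrier G" for x g
  proof -
    have "group_conj G x g [^] (n::nat) = group_conj G (x [^] n) g" for n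
      using x g Ac by (induction n) (simp_all add: conj_mult)
    then show ?thesis using x g invariant_subgroupD(2)[OF A] invariant_subgroupD(2)[OF N] by auto
  qed
  ultimately show ?thesis by (simp add: invariant_subgroup_def)
qed

end

text \<open>\<open>elementary_abelian_lower_terminates\<close> applied to the image of \<open>A\<close> in the quotient by \<open>N\<close>.\<close>

lemma elementary_abelian_factor_lower_terminates:
  fixes G :: "'a monoid" (structure)
  assumes G: "group G" and sep: "finite_index_separable G" and p: "Factorial_Ring.prime p"
    and A: "invariant_subgroup G (carrier G) A" and N: "invariant_subgroup G (carrier G) N"
    and abel: "\<And>x y. x \<in> A \<Longrightarrow> y \<in> A \<Longrightarrow> group_comm G x y \<in> N"
    and expo: "\<And>x. x \<in> A \<Longrightarrow> x [^] (p::nat) \<in> N"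
    and res: "residually_hypercentral G A"
  shows "\<exists>j. rel_lower G (carrier G) A j \<subseteq> N"
proof -
  interpret group G by fact
  have "N \<lhd> G" using N by (simp add: normal_iff_invariant)
  then obtain H :: "'a monoid" and h where H: "group_epi G H h"
    "\<And>x. x \<in> carrier G \<Longrightarrow> h x = \<one>\<^bsub>H\<^esub> \<longleftrightarrow> x \<in> N"
    using quotient_copy by blast
  interpret h: group_epi G H h by fact
  have As: "subgroup A G" using invariant_subgroupD(1)[OF A] .
  have Ac: "\<And>x. x \<in> A \<Longrightarrow> x \<in> carrier G" using subgroup_memD[OF As] .
  have "\<exists>j. rel_lower H (carrier H) (h ` A) j \<subseteq> {\<one>\<^bsub>H\<^esub>}"
  proof (rule h.H.elementary_abelian_lower_terminates[OF h.finite_index_separable_image[OF sep] p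
        h.invariant_subgroup_image[OF A] _ _ h.residually_hypercentral_image[OF As res]])
    fix x y assume "x \<in> h ` A" "y \<in> h ` A"
    then obtain u v where uv: "u \<in> A" "v \<in> A" "x = h u" "y = h v" by blast
    have "h (group_comm G u v) = \<one>\<^bsub>H\<^esub>" using H(2)[of "group_comm G u v"] abel[OF uv(1,2)] Ac[OF uv(1)] Ac[OF uv(2)] comm_closed by blast
    then show "x \<otimes>\<^bsub>H\<^esub> y = y \<otimes>\<^bsub>H\<^esub> x"
      unfolding uv(3,4) by (intro h.image_commute Ac uv)
  next
    fix x assume "x \<in> h ` A"
    then obtain u where u: "u \<in> A" "x = h u" by blast
    have "h (u [^] p) = \<one>\<^bsub>H\<^esub>" using H(2) expo[OF u(1)] Ac u(1) by simp
    then show "x [^]\<^bsub>H\<^esub> p = \<one>\<^bsub>H\<^esub>" using u Ac by (simp add: h.hom_nat_pow)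
  qed
  then show ?thesis using h.rel_lower_subset_kernel[OF As] H(2) by blast
qed

text \<open>Induction on the exponent \<open>m = p n\<close>: the elements of \<open>A\<close> whose \<open>n\<close>-th power lies in \<open>N\<close> form a subgroup \<open>B\<close>,
  the factor \<open>A/B\<close> is elementary abelian, and \<open>B/N\<close> has the smaller exponent \<open>n\<close>.\<close>

lemma bounded_abelian_factor_lower_terminates:
  fixes G :: "'a monoid" (structure)
  assumes G: "group G" and sep: "finite_index_separable G"
    and N: "invariant_subgroup G (carrier G) N"
    and "invariant_subgroup G (carrier G) A"
    and "\<And>x y. x \<in> A \<Longrightarrow> y \<in> A \<Longrightarrow> group_comm G x y \<in> N"
    and "(m::nat) > 0" "\<And>x. x \<in> A \<Longrightarrow> x [^] m \<in> N"
    and "residually_hypercentral G A"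
  shows "\<exists>j. rel_lower G (carrier G) A j \<subseteq> N"
  using assms(4-)
proof (induction m arbitrary: A rule: less_induct)
  case (less m)
  interpret group G by fact
  note A = less.prems(1) and abel = less.prems(2) and expo = less.prems(4) and res = less.prems(5)
  have As: "subgroup A G" using invariant_subgroupD(1)[OF A] .
  have Ac: "\<And>x. x \<in> A \<Longrightarrow> x \<in> carrier G" using subgroup_memD[OF As] .
  show ?case
  proof (cases "m = 1")
    case True
    then have "x \<in> N" if "x \<in> A" for x using expo[OF that] Ac[OF that] by simp
    then have "rel_lower G (carrier G) A 0 \<subseteq> N" by auto
    then show ?thesis by blast
  next
    case False
    then obtain p where p: "Factorial_Ring.prime p" "p dvd m" using prime_factor_nat by blast
    obtain n where n: "m = p * n" using p(2) by (elim dvdE)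
    have n0: "n > 0" using n less.prems(3) by (cases n) auto
    have nm: "n < m" using n n0 prime_gt_1_nat[OF p(1)] by simp
    define B where "B = {x \<in> A. x [^] n \<in> N}"
    have B: "invariant_subgroup G (carrier G) B" unfolding B_def
      by (rule invariant_subgroup_power_in[OF A N abel])
    have BA: "B \<subseteq> A" by (auto simp: B_def)
    have "\<exists>j. rel_lower G (carrier G) A j \<subseteq> B"
    proof (rule elementary_abelian_factor_lower_terminates[OF G sep p(1) A B _ _ res])
      show "group_comm G x y \<in> B" if "x \<in> A" "y \<in> A" for x y
        using abel[OF that] subgroup_comm[OF As that] subgroup_pow[OF invariant_subgroupD(1)[OF N]]
        by (simp add: B_def)
      show "x [^] p \<in> B" if "x \<in> A" for x
        using expo[OF that] Ac[OF that] subgroup_pow[OF As that] n by (simp add: B_def nat_pow_pow)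
    qed
    then obtain j where j: "rel_lower G (carrier G) A j \<subseteq> B" by blast
    have "\<exists>i. rel_lower G (carrier G) B i \<subseteq> N"
    proof (rule less.IH[OF nm B _ n0 _ residually_hypercentral_subset[OF res BA]])
      show "group_comm G x y \<in> N" if "x \<in> B" "y \<in> B" for x y using abel that BA by blast
      show "x [^] n \<in> N" if "x \<in> B" for x using that by (simp add: B_def)
    qed
    then obtain i where i: "rel_lower G (carrier G) B i \<subseteq> N" by blast
    have "rel_lower G (carrier G) A (j + i) \<subseteq> N"
      using rel_lower_base_mono[OF j, of "carrier G" i] i unfolding rel_lower_add by (rule order_trans)
    then show ?thesis by blast
  qed
qed

section \<open>Right Engel elements of finite order in FC*-groups\<close>

context group
begin

text \<open>Exponents of lower central factors do not grow: modulo \<open>[M, \<dots>, M]\<close> with one entry more, commutators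
  \<open>[x, g]\<close> commute with \<open>M\<close>, so \<open>[x, g]\<^sup>m = [x\<^sup>m, g]\<close>, which is trivial there because \<open>x\<^sup>m\<close> already lies one step
  further down than \<open>x\<close>.\<close>

lemma lower_factor_exponent:
  assumes M: "invariant_subgroup G (carrier G) M"
    and m: "\<And>x. x \<in> M \<Longrightarrow> x [^] (m::nat) \<in> rel_lower G M M 1"
  shows "x \<in> rel_lower G M M i \<Longrightarrow> x [^] m \<in> rel_lower G M M (Suc i)"
proof (induction i arbitrary: x)
  case 0
  then show ?case using m by simp
next
  case (Suc i)
  let ?L = "rel_lower G M M"
  have Ms: "subgroup M G" using invariant_subgroupD(1)[OF M] .
  have Mc: "M \<subseteq> carrier G" using Ms by (rule subgroup.subset)
  note Minv = invariant_subgroup_self[OF Ms]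
  have Linv: "invariant_subgroup G (carrier G) (?L j)" for j
    by (rule invariant_subgroup_rel_lower[OF subset_refl M M])
  have LM: "?L j \<subseteq> M" for j using rel_lower_mono[OF Mc Minv Minv, of 0 j] by simp
  have "?L (Suc (Suc i)) \<lhd> G" using Linv by (simp only: normal_iff_invariant)
  then obtain H :: "'a monoid" and h where H: "group_epi G H h"
    "\<And>x. x \<in> carrier G \<Longrightarrow> h x = \<one>\<^bsub>H\<^esub> \<longleftrightarrow> x \<in> ?L (Suc (Suc i))"
    using quotient_copy by blast
  interpret h: group_epi G H h by fact
  let ?B = "{x \<in> ?L (Suc i). x [^] m \<in> ?L (Suc (Suc i))}"
  have "invariant_subgroup G (carrier G) ?B"
  proof (rule invariant_subgroup_power_in[OF Linv Linv])
    show "group_comm G x y \<in> ?L (Suc (Suc i))" if "x \<in> ?L (Suc i)" "y \<in> ?L (Suc i)" for x y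
      using that(1) subsetD[OF LM that(2)] by (rule comm_in_rel_lower)
  qed
  then have "subgroup ?B G" by (rule invariant_subgroupD(1))
  then have "?L (Suc i) \<subseteq> ?B"
  proof (rule rel_lower_Suc_leI)
    fix x g assume xg: "x \<in> ?L i" "g \<in> M"
    have c: "group_comm G x g \<in> ?L (Suc i)" by (rule comm_in_rel_lower[OF xg])
    have xM: "x \<in> M" using xg LM by blast
    have car: "x \<in> carrier G" "g \<in> carrier G" using xM xg Mc by auto
    have "group_comm G (group_comm G x g) x \<in> ?L (Suc (Suc i))" by (rule comm_in_rel_lower[OF c xM])
    then have "group_comm H (group_comm H (h x) (h g)) (h x) = \<one>\<^bsub>H\<^esub>"
      using H(2)[of "group_comm G (group_comm G x g) x"] car by simp
    then have "group_comm H (h x) (h g) \<otimes>\<^bsub>H\<^esub> h x = h x \<otimes>\<^bsub>H\<^esub> group_comm H (h x) (h g)"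
      using h.H.comm_eq_one_iff[of "group_comm H (h x) (h g)" "h x"] car by simp
    then have "group_comm H (h x) (h g) [^]\<^bsub>H\<^esub> m = group_comm H (h x [^]\<^bsub>H\<^esub> m) (h g)"
      using h.H.comm_pow_left[of "h x" "h g" m] car by simp
    also have "\<dots> = h (group_comm G (x [^] m) g)" using car by (simp add: h.hom_nat_pow)
    also have "\<dots> = \<one>\<^bsub>H\<^esub>"
      using H(2)[of "group_comm G (x [^] m) g"] comm_in_rel_lower[OF Suc.IH[OF xg(1)] xg(2)] car by simp
    finally have "h (group_comm G x g [^] m) = \<one>\<^bsub>H\<^esub>" using car by (simp add: h.hom_nat_pow)
    then have "group_comm G x g [^] m \<in> ?L (Suc (Suc i))" using H(2) car by simp
    then show "group_comm G x g \<in> ?B" using c by blast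
  qed
  then show ?case using Suc.prems by blast
qed

lemma elem_normal_closure_invariant:
  "x \<in> carrier G \<Longrightarrow> invariant_subgroup G (carrier G) (elem_normal_closure G x)"
  using elem_normal_closure_normal[OF group_axioms] by (simp add: normal_iff_invariant)

lemma elem_normal_closure_self: "x \<in> elem_normal_closure G x"
  using generate.incl[of x "{x}" G] by (auto simp: elem_normal_closure_def normal_closure_def)

lemma elem_normal_closure_least:
  assumes "invariant_subgroup G (carrier G) V" "x \<in> V"
  shows "elem_normal_closure G x \<subseteq> V"
proof -
  have "generate G {x} \<subseteq> V" 
    using generate_subgroup_incl[of "{x}" V] assms invariant_subgroupD(1) by blast
  moreover have "V \<lhd> G" using assms by (simp add: normal_iff_invariant)
  ultimately show ?thesis by (auto simp: elem_normal_closure_def normal_closure_def)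
qed

end

text \<open>Baer's theorem in the finite quotient by the core of \<open>K\<close>.\<close>

lemma right_engel_residually_hypercentral:
  fixes G :: "'a monoid" (structure)
  assumes G: "group G" and a: "a \<in> carrier G"
    and engel: "\<And>g. g \<in> carrier G \<Longrightarrow> \<exists>m. engel_comm G a m g = \<one>"
  shows "residually_hypercentral G (elem_normal_closure G a)"
  unfolding residually_hypercentral_def
proof (intro allI impI)
  interpret group G by fact
  fix K assume "finite_index_subgroup K G"
  then obtain H :: "'a monoid" and h where H: "group_epi G H h" "finite (carrier H)"
    "\<And>x. x \<in> carrier G \<Longrightarrow> h x = \<one>\<^bsub>H\<^esub> \<Longrightarrow> x \<in> K"
    using finite_quotient_below by blast
  interpret h: group_epi G H h by fact
  let ?N = "{x \<in> carrier G. h x \<in> {\<one>\<^bsub>H\<^esub>}}"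
  have N: "invariant_subgroup G (carrier G) ?N"
    using h.subgroup_preimage[OF h.H.triv_subgroup] by (auto simp: invariant_subgroup_def)
  have "\<exists>k. h a \<in> rel_upper H (carrier H) {\<one>\<^bsub>H\<^esub>} k"
  proof (rule finite_right_engel_hypercentral[OF h.H.group_axioms H(2)])
    fix y assume "y \<in> carrier H"
    then obtain g where g: "g \<in> carrier G" "h g = y" unfolding h.surj[symmetric] by blast
    obtain m where "engel_comm G a m g = \<one>" using engel[OF g(1)] by blast
    then have "engel_comm H (h a) m y = \<one>\<^bsub>H\<^esub>" using h.hom_engel[OF a g(1), of m] g(2) by simp
    then show "\<exists>m. engel_comm H (h a) m y = \<one>\<^bsub>H\<^esub>" by blast
  qed (use a in simp)
  then obtain k where "a \<in> rel_upper G (carrier G) ?N k" using h.rel_upper_preimage_iff[OF a] by blast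
  then have "elem_normal_closure G a \<subseteq> rel_upper G (carrier G) ?N (0 + k)"
    using elem_normal_closure_least[OF invariant_subgroup_rel_upper[OF subgroup_self N]] by simp
  then have "rel_lower G (carrier G) (elem_normal_closure G a) k \<subseteq> rel_upper G (carrier G) ?N 0"
    by (rule rel_lower_subset_if_rel_upper[OF subgroup_self N])
  then show "\<exists>k. rel_lower G (carrier G) (elem_normal_closure G a) k \<subseteq> K" using H(3) by auto
qed

text \<open>Descend along the lower central series of \<open>M\<close>. Its factors are abelian of exponent dividing \<open>m\<close>: for the
  first factor, the elements of \<open>M\<close> whose \<open>m\<close>-th power lies in \<open>[M, M]\<close> form a normal subgroup containing
  \<open>a\<close>, and \<open>M\<close> is the smallest one.\<close>

lemma nilpotent_closure_lower_terminates:
  fixes G :: "'a monoid" (structure)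
  assumes G: "group G" and sep: "finite_index_separable G" and a: "a \<in> carrier G"
    and m: "(m::nat) > 0" "a [^] m = \<one>"
    and M: "M = elem_normal_closure G a" and c: "rel_lower G M M c \<subseteq> {\<one>}"
    and res: "residually_hypercentral G M"
  shows "\<exists>j. rel_lower G (carrier G) M j \<subseteq> {\<one>}"
proof -
  interpret group G by fact
  let ?L = "rel_lower G M M"
  have Minv: "invariant_subgroup G (carrier G) M" unfolding M by (rule elem_normal_closure_invariant[OF a])
  have Ms: "subgroup M G" using invariant_subgroupD(1)[OF Minv] .
  have Mc: "M \<subseteq> carrier G" using Ms by (rule subgroup.subset)
  note MM = invariant_subgroup_self[OF Ms]
  have Linv: "invariant_subgroup G (carrier G) (?L j)" for j
    by (rule invariant_subgroup_rel_lower[OF subset_refl Minv Minv])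
  have LM: "?L j \<subseteq> M" for j using rel_lower_mono[OF Mc MM MM, of 0 j] by simp
  have comm: "group_comm G x y \<in> ?L (Suc i)" if "x \<in> ?L i" "y \<in> ?L i" for i x y
    using that(1) subsetD[OF LM that(2)] by (rule comm_in_rel_lower)
  have "invariant_subgroup G (carrier G) {x \<in> ?L 0. x [^] m \<in> ?L 1}"
    by (rule invariant_subgroup_power_in[OF Linv Linv]) (use comm[of _ 0] in simp)
  moreover have "a \<in> {x \<in> ?L 0. x [^] m \<in> ?L 1}"
    using m(2) elem_normal_closure_self subgroup.one_closed[OF invariant_subgroupD(1)[OF Linv]] M
    by (simp del: rel_lower.simps(2))
  ultimately have "M \<subseteq> {x \<in> ?L 0. x [^] m \<in> ?L 1}" unfolding M by (rule elem_normal_closure_least)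
  then have expo: "x [^] m \<in> ?L (Suc i)" if "x \<in> ?L i" for x i
    using lower_factor_exponent[OF Minv _ that] by blast
  have "\<exists>j. rel_lower G (carrier G) M j \<subseteq> ?L i" for i
  proof (induction i)
    case 0
    have "rel_lower G (carrier G) M 0 \<subseteq> ?L 0" by simp
    then show ?case by blast
  next
    case (Suc i)
    then obtain j where j: "rel_lower G (carrier G) M j \<subseteq> ?L i" by blast
    obtain j' where j': "rel_lower G (carrier G) (?L i) j' \<subseteq> ?L (Suc i)"
      using bounded_abelian_factor_lower_terminates[OF G sep Linv Linv comm m(1) expo
        residually_hypercentral_subset[OF res LM]] by blast
    have "rel_lower G (carrier G) M (j + j') \<subseteq> ?L (Suc i)"
      using rel_lower_base_mono[OF j, of "carrier G" j'] j' unfolding rel_lower_add by (rule order_trans)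
    then show ?case by blast
  qed
  then show ?thesis using c by (meson order_trans)
qed

text \<open>For \<open>n = 0\<close> this is Baer's theorem. Otherwise let \<open>M\<close> be the normal closure of \<open>a\<close> and \<open>C\<close> its
  centralizer. By induction \<open>a\<close> is hypercentral modulo \<open>C\<close>, so some term \<open>[M, M, \<dots>, M]\<close> centralizes \<open>M\<close> and
  the next one is trivial.\<close>

lemma FC_separable_right_engel_hypercentral:
  fixes G :: "'a monoid"
  assumes "FC_group n G" "finite_index_separable G" "a \<in> carrier G"
    and "\<And>g. g \<in> carrier G \<Longrightarrow> \<exists>m. engel_comm G a m g = \<one>\<^bsub>G\<^esub>"
    and "(m::nat) > 0" "a [^]\<^bsub>G\<^esub> m = \<one>\<^bsub>G\<^esub>"
  shows "\<exists>k. a \<in> rel_upper G (carrier G) {\<one>\<^bsub>G\<^esub>} k"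
  using assms
proof (induction n arbitrary: G a)
  case 0
  then show ?case by (intro finite_right_engel_hypercentral) simp_all
next
  case (Suc n)
  note sep = Suc.prems(2) and a = Suc.prems(3) and engel = Suc.prems(4)
  have G: "group G" using FC_group_is_group[OF Suc.prems(1)] .
  interpret group G by fact
  define M where "M = elem_normal_closure G a"
  define C where "C = centralizer G M"
  have Minv: "invariant_subgroup G (carrier G) M" unfolding M_def by (rule elem_normal_closure_invariant[OF a])
  have Ms: "subgroup M G" using invariant_subgroupD(1)[OF Minv] .
  have Mc: "M \<subseteq> carrier G" using Ms by (rule subgroup.subset)
  have CN: "C \<lhd> G" unfolding C_def
    by (rule centralizer_normal[OF G]) (use Minv in \<open>simp add: normal_iff_invariant\<close>)
  then have Cinv: "invariant_subgroup G (carrier G) C" by (simp add: normal_iff_invariant)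
  interpret C: normal C G by (rule CN)
  obtain H :: "'a monoid" where H: "G Mod C \<cong> H" "FC_group n H"
    using Suc.prems(1) a unfolding C_def M_def by auto
  obtain f where f: "f \<in> iso (G Mod C) H" using H(1) by (auto simp: is_iso_def)
  have Hg: "group H" using FC_group_is_group[OF H(2)] .
  define h where "h = f \<circ> (\<lambda>x. C #>\<^bsub>G\<^esub> x)"
  have hC: "h x = \<one>\<^bsub>H\<^esub> \<longleftrightarrow> x \<in> C" if "x \<in> carrier G" for x
    unfolding h_def using group_epi_compose_iso(2)[OF C.group_epi_Mod(1) f Hg that] C.group_epi_Mod(2)[OF that] by simp
  interpret h: group_epi G H h
    unfolding h_def by (rule group_epi_compose_iso(1)[OF C.group_epi_Mod(1) f Hg])
  have "\<exists>k. h a \<in> rel_upper H (carrier H) {\<one>\<^bsub>H\<^esub>} k"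
  proof (rule Suc.IH[OF H(2) h.finite_index_separable_image[OF sep]])
    show "h a \<in> carrier H" using a by simp
    show "m > 0" by fact
    show "h a [^]\<^bsub>H\<^esub> m = \<one>\<^bsub>H\<^esub>" using Suc.prems(6) a by (simp flip: h.hom_nat_pow)
    fix y assume "y \<in> carrier H"
    then obtain g where g: "g \<in> carrier G" "h g = y" unfolding h.surj[symmetric] by blast
    obtain m where "engel_comm G a m g = \<one>\<^bsub>G\<^esub>" using engel[OF g(1)] by blast
    then have "engel_comm H (h a) m y = \<one>\<^bsub>H\<^esub>" using h.hom_engel[OF a g(1), of m] g(2) by simp
    then show "\<exists>m. engel_comm H (h a) m y = \<one>\<^bsub>H\<^esub>" by blast
  qed
  then obtain k where "a \<in> rel_upper G (carrier G) {x \<in> carrier G. h x \<in> {\<one>\<^bsub>H\<^esub>}} k"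
    using h.rel_upper_preimage_iff[OF a] by blast
  moreover have "{x \<in> carrier G. h x \<in> {\<one>\<^bsub>H\<^esub>}} = C" using hC C.subset by auto
  ultimately have "M \<subseteq> rel_upper G (carrier G) C (0 + k)" unfolding M_def
    using elem_normal_closure_least[OF invariant_subgroup_rel_upper[OF subgroup_self Cinv]] by simp
  then have "rel_lower G (carrier G) M k \<subseteq> rel_upper G (carrier G) C 0"
    by (rule rel_lower_subset_if_rel_upper[OF subgroup_self Cinv])
  then have LC: "rel_lower G M M k \<subseteq> C"
    using rel_lower_acting_mono[OF Mc, of M k] by auto
  have "rel_lower G M M (Suc k) \<subseteq> {\<one>\<^bsub>G\<^esub>}"
  proof (rule rel_lower_Suc_leI[OF triv_subgroup])
    fix x g assume xg: "x \<in> rel_lower G M M k" "g \<in> M"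
    have "x \<in> C" using xg LC by blast
    then have x: "x \<in> carrier G" "x \<otimes>\<^bsub>G\<^esub> g = g \<otimes>\<^bsub>G\<^esub> x"
      using xg(2) unfolding C_def centralizer_def by blast+
    then have "group_comm G x g = \<one>\<^bsub>G\<^esub>" using comm_eq_one_iff[OF x(1) subsetD[OF Mc xg(2)]] by blast
    then show "group_comm G x g \<in> {\<one>\<^bsub>G\<^esub>}" by blast
  qed
  then obtain j where j: "rel_lower G (carrier G) M j \<subseteq> {\<one>\<^bsub>G\<^esub>}"
    using nilpotent_closure_lower_terminates[OF G sep a Suc.prems(5,6) M_def]
      right_engel_residually_hypercentral[OF G a engel] unfolding M_def by blast
  have "M \<subseteq> rel_upper G (carrier G) {\<one>\<^bsub>G\<^esub>} (0 + j)"
  proof (rule rel_upper_if_rel_lower_subset)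
    show "rel_lower G (carrier G) M j \<subseteq> rel_upper G (carrier G) {\<one>\<^bsub>G\<^esub>} 0" using j by simp
    show "rel_lower G (carrier G) M i \<subseteq> carrier G" for i
      using invariant_subgroup_rel_lower[OF subset_refl Minv invariant_subgroup_self[OF subgroup_self]]
      by (meson invariant_subgroupD(1) subgroup.subset)
  qed
  then show ?case using elem_normal_closure_self[of a] unfolding M_def by auto
qed

section \<open>The upper central series\<close>

lemma (in group) upper_central_eq: "upper_central G k = rel_upper G (carrier G) {\<one>} k"
proof (induction k)
  case (Suc k)
  let ?Z = "rel_upper G (carrier G) {\<one>} k"
  have "?Z \<lhd> G"
    using invariant_subgroup_rel_upper[OF subgroup_self invariant_subgroup_one[OF subset_refl]]
    by (simp only: normal_iff_invariant)
  then interpret Z: normal ?Z G .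
  interpret h: group_epi G "G Mod ?Z" "\<lambda>x. ?Z #> x" by (rule Z.group_epi_Mod(1))
  have "?Z #> g \<in> group_center (G Mod ?Z) \<longleftrightarrow> (\<forall>x\<in>carrier G. group_comm G g x \<in> ?Z)"
    if g: "g \<in> carrier G" for g
  proof -
    have "(?Z #> g) \<otimes>\<^bsub>G Mod ?Z\<^esub> (?Z #> x) = (?Z #> x) \<otimes>\<^bsub>G Mod ?Z\<^esub> (?Z #> g) \<longleftrightarrow> group_comm G g x \<in> ?Z"
      if x: "x \<in> carrier G" for x
      using h.H.comm_eq_one_iff[OF h.hom_closed[OF g] h.hom_closed[OF x]] h.hom_comm[OF g x]
        Z.group_epi_Mod(2)[of "group_comm G g x"] g x by simp
    then have "(\<forall>y\<in>carrier (G Mod ?Z). (?Z #> g) \<otimes>\<^bsub>G Mod ?Z\<^esub> y = y \<otimes>\<^bsub>G Mod ?Z\<^esub> (?Z #> g))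
        \<longleftrightarrow> (\<forall>x\<in>carrier G. group_comm G g x \<in> ?Z)" unfolding h.ball_surj by simp
    moreover have "?Z #> g \<in> carrier (G Mod ?Z)" using h.hom_closed[OF g] .
    ultimately show ?thesis unfolding group_center_def centralizer_def by blast
  qed
  then show ?case unfolding upper_central.simps rel_upper.simps Suc.IH by blast
qed simp

theorem proposition2p6:
  fixes G :: "'a monoid"
  assumes "group G" and "FC_star_group G" and "ERF_group G"
  shows "(\<forall>a. a \<in> right_engel G \<and> finite_order_elem G a \<longrightarrow> (\<exists>k. a \<in> upper_central G k)) \<and>
    (periodic_group G \<longrightarrow>
      right_engel G = bounded_right_engel G \<and> bounded_right_engel G = upper_central_omega G)"
proof -
  interpret group G by fact
  obtain n where n: "FC_group n G" using assms(2) by (auto simp: FC_star_group_def)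
  have first: "\<exists>k. a \<in> upper_central G k" if a: "a \<in> right_engel G" "finite_order_elem G a" for a
  proof -
    have ac: "a \<in> carrier G" and engel: "\<And>g. g \<in> carrier G \<Longrightarrow> \<exists>m. engel_comm G a m g = \<one>\<^bsub>G\<^esub>"
      using a(1) by (auto simp: right_engel_def)
    obtain m where m: "m > 0" "a [^]\<^bsub>G\<^esub> (m::nat) = \<one>\<^bsub>G\<^esub>" using a(2) by (auto simp: finite_order_elem_def)
    show ?thesis unfolding upper_central_eq
      by (rule FC_separable_right_engel_hypercentral[OF n ERF_group_separable[OF assms(3)] ac engel m])
  qed
  have "right_engel G = bounded_right_engel G \<and> bounded_right_engel G = upper_central_omega G"
    if per: "periodic_group G"
  proof -
    have "right_engel G \<subseteq> upper_central_omega G"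
      using first per by (auto simp: upper_central_omega_def periodic_group_def right_engel_def)
    moreover have "upper_central_omega G \<subseteq> bounded_right_engel G"
    proof
      fix a assume "a \<in> upper_central_omega G"
      then obtain k where k: "a \<in> rel_upper G (carrier G) {\<one>\<^bsub>G\<^esub>} k"
        by (auto simp: upper_central_omega_def upper_central_eq)
      have ac: "a \<in> carrier G" using k rel_upper_subset[of "{\<one>\<^bsub>G\<^esub>}" "carrier G"] by auto
      \<comment> \<open>the successor provides a length of at least 1 even for \<open>k = 0\<close>\<close>
      have "engel_comm G a (Suc k) g = \<one>\<^bsub>G\<^esub>" if g: "g \<in> carrier G" for g
        using engel_in_rel_upper[OF k g] g by simp
      then have "\<exists>m\<ge>1. \<forall>g\<in>carrier G. engel_comm G a m g = \<one>\<^bsub>G\<^esub>" by (intro exI[of _ "Suc k"]) auto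
      then show "a \<in> bounded_right_engel G" using ac by (simp add: bounded_right_engel_def)
    qed
    moreover have "bounded_right_engel G \<subseteq> right_engel G"
      by (auto simp: bounded_right_engel_def right_engel_def)
    ultimately show ?thesis by blast
  qed
  then show ?thesis using first by blast
qed

end
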